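(* The minimal order of a reversible nonsymmetric ring is $256$. That is, there exists a reversible ring of order $256$ that is not symmetric, and every reversible ring of order less than $256$ is symmetric.
   Context: All rings are finite, associative, with unity (not assumed commutative). A ring $R$ is reversible if for all $a,b\in R$, $ab=0$ implies $ba=0$. A ring $R$ is symmetric if for all $a,b,c\in R$, $abc=0$ implies $bac=0$. Nonsymmetric means not symmetric. Minimal means of smallest cardinality. *)

theory Defs
  imports "HOL-Algebra.Ring" "HOL-Algebra.Coset"
begin

locale reversible_ring = ring +
  assumes reversible:
    "\<lbrakk>a \<in> carrier R; b \<in> carrier R; a \<otimes> b = \<zero>\<rbrakk> \<Longrightarrow> b \<otimes> a = \<zero>"

locale symmetric_ring = ring +
  assumes symmetric:
    "\<lbrakk>a \<in> carrier R; b \<in> carrier R; c \<in> carrier R; a \<otimes> b \<otimes> c = \<zero>\<rbrakk> \<Longrightarrow> b \<otimes> a \<otimes> c = \<zero>"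

end

theory Submission
  imports Defs "HOL-Computational_Algebra.Primes" "HOL-Algebra.Multiplicative_Group"
    "HOL-Algebra.Weak_Morphisms"
begin

text \<open>
  The ring of order 256 consists of skew polynomials of degree at most four over the field with four
  elements, with constant coefficient in the prime field and with the top coefficient replaced by its
  trace. Leading coefficients do not multiply to zero below the top degree, and in the top degree
  the trace does not see the twist of a product of two factors; this makes the ring reversible. It does
  see the twist for three factors.

  For the lower bound, note that in a reversible ring a vanishing product stays zero after a cyclic rotation
  of its factors (\<open>zero_rotate\<close>) and after insertion of further factors (\<open>zero_insert\<close>). In
  particular idempotents are central. Suppose \<open>abc = 0\<close> and \<open>bac \<noteq> 0\<close>. Passing to a suitable corner, and
  replacing \<open>c\<close> by a multiple, one may assume that \<open>a, b, c\<close> and a prime \<open>p\<close> are nilpotent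
  (\<open>common_nilpotent_corner\<close>). Let \<open>J k\<close> be the additive span of all products of at least \<open>k\<close> of
  these four elements. This is a descending chain that reaches zero, its quotients are vector spaces
  over the field with \<open>p\<close> elements, and the identity of the corner lies outside \<open>J 1\<close>. So the order of the
  ring is at least \<open>p\<close> to the power \<open>1 + n1 + n2 + n3 + \<dots>\<close>, where \<open>nk\<close> is the dimension of
  \<open>J k\<close> modulo \<open>J (k + 1)\<close>.

  The dimensions are bounded below by showing that small ones force triple products to be invariant under
  reversal. If \<open>n1 = 1\<close> then \<open>J 1\<close> is commutative (\<open>cyclic_top_commutative\<close>). If \<open>n2 = 1\<close> then
  \<open>J 1\<close> splits into polynomials in one element and its annihilator
  (\<open>cyclic_square_reversal\<close>). Also \<open>n3 \<ge> 1\<close>, because \<open>cba\<close> is nonzero. This yields \<open>p\<^sup>6\<close>, which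
  exceeds 256 for odd \<open>p\<close>. For \<open>p = 2\<close> the total \<open>n1 + n2 + n3 + \<dots>\<close> must be shown to be at least seven. If \<open>J 4\<close> is
  zero, then a count of classes that are separated by the triple product suffices
  (\<open>fourth_power_zero_bounds\<close>). Otherwise the only possibility left is 2, 2, 1, 1, in
  which case \<open>J 1\<close> is again governed by one element with nonzero fourth power
  (\<open>order_2_2_1_1_reversal\<close>).
\<close>

section \<open>A reversible nonsymmetric ring of order 256\<close>

text \<open>
  The field with four elements: \<open>F4 r s\<close> stands for \<open>r + s \<omega>\<close>, where \<open>\<omega>\<^sup>2 = \<omega> + 1\<close>.
\<close>
datatype f4 = F4 (re: bool) (im: bool)

instantiation f4 :: comm_ring_1
begin
definition zero_f4 where "0 = F4 False False"
definition one_f4 where "1 = F4 True False"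
definition plus_f4 where "x + y = F4 (re x \<noteq> re y) (im x \<noteq> im y)"
definition uminus_f4 where "- x = (x :: f4)"
definition minus_f4 where "x - y = x + (y :: f4)"
definition times_f4 where
  "x * y = F4 ((re x \<and> re y) \<noteq> (im x \<and> im y))
              (((re x \<and> im y) \<noteq> (im x \<and> re y)) \<noteq> (im x \<and> im y))"
instance
  by standard
    (auto simp: zero_f4_def one_f4_def plus_f4_def uminus_f4_def minus_f4_def times_f4_def
      f4.expand)
end

lemmas f4_defs = zero_f4_def one_f4_def plus_f4_def times_f4_def

lemma f4_no_zero_divisors: "x * y = 0 \<longleftrightarrow> x = 0 \<or> y = (0::f4)"
  by (cases x; cases y) (auto simp: f4_defs)

text \<open>
  The nontrivial automorphism of the field and the trace to the prime field.
\<close>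
definition frob :: "f4 \<Rightarrow> f4" where "frob x = x * x"
definition tr :: "f4 \<Rightarrow> f4" where "tr x = x + frob x"

lemma frob_simps [simp]:
  "frob (x + y) = frob x + frob y" "frob (x * y) = frob x * frob y" "frob (frob x) = x"
  "frob 0 = 0" "frob 1 = 1"
  "frob x = 0 \<longleftrightarrow> x = 0"
  by (cases x; cases y; auto simp: frob_def f4_defs)+

definition prime_subfield :: "f4 set" where "prime_subfield = {0, 1}"

lemma prime_subfield_iff: "k \<in> prime_subfield \<longleftrightarrow> frob k = k"
  by (cases k) (auto simp: prime_subfield_def frob_def f4_defs)

lemma tr_simps [simp]: 
  "tr (x + y) = tr x + tr y" "tr (frob x) = tr x" "tr 0 = 0" 
  "frob (tr x) = tr x"
  by (simp_all add: tr_def algebra_simps)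

type_synonym skew = "f4 \<times> f4 \<times> f4 \<times> f4 \<times> f4"

text \<open>
  Skew polynomials in \<open>x\<close> over the four-element field, with \<open>x a = frob a x\<close>. The tuple lists the
  coefficients of \<open>1, x, x\<^sup>2, x\<^sup>3, x\<^sup>4\<close> and powers beyond the fourth vanish. The constant coefficient lies
  in the prime field, so the ring is local with residue field of order two. The top coefficient is
  recorded only through its trace; this loses exactly one bit, on which nonsymmetry rests.
\<close>
fun skew_mult :: "skew \<Rightarrow> skew \<Rightarrow> skew" where
  "skew_mult (a0, a1, a2, a3, a4) (b0, b1, b2, b3, b4) =
     (a0 * b0,
      a0 * b1 + a1 * b0,
      a0 * b2 + a1 * frob b1 + a2 * b0,
      a0 * b3 + a1 * frob b2 + a2 * b1 + a3 * b0,
      a0 * b4 + tr (a1 * frob b3 + a2 * b2 + a3 * frob b1) + a4 * b0)"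

definition skew_ring :: "skew ring" where
  "skew_ring = \<lparr> carrier = prime_subfield \<times> UNIV \<times> UNIV \<times> UNIV \<times> prime_subfield,
     monoid.mult = skew_mult, one = (1, 0, 0, 0, 0), zero = (0, 0, 0, 0, 0),
     add = (\<lambda>(a0, a1, a2, a3, a4) (b0, b1, b2, b3, b4).
        (a0 + b0, a1 + b1, a2 + b2, a3 + b3, a4 + b4)) \<rparr>"

lemma f4_double: "x + x = (0::f4)" 
  by (cases x) (auto simp: f4_defs)

text \<open>
  Associativity reduces to identities between coefficients. They hold because \<open>frob\<close> is an
  involution under which the trace is invariant, and because the trace is linear over the constant
  coefficients 0 and 1.
\<close>
lemma ring_skew: "ring skew_ring"
proof (rule ringI)
  show "abelian_group skew_ring"
  proof (rule abelian_groupI)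
    fix x assume "x \<in> carrier skew_ring"
    then show "\<exists>y\<in>carrier skew_ring. y \<oplus>\<^bsub>skew_ring\<^esub> x = \<zero>\<^bsub>skew_ring\<^esub>"
      by (intro bexI[of _ x]) (auto simp: skew_ring_def f4_double)
  qed (auto simp: skew_ring_def prime_subfield_iff add_ac)
  show "monoid skew_ring"
  proof (rule monoidI)
    fix x y z assume "x \<in> carrier skew_ring" "y \<in> carrier skew_ring" "z \<in> carrier skew_ring"
    then show "x \<otimes>\<^bsub>skew_ring\<^esub> y \<otimes>\<^bsub>skew_ring\<^esub> z = x \<otimes>\<^bsub>skew_ring\<^esub> (y \<otimes>\<^bsub>skew_ring\<^esub> z)"
      by (auto simp: skew_ring_def prime_subfield_def algebra_simps)
  qed (auto simp: skew_ring_def prime_subfield_iff)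
qed (auto simp: skew_ring_def algebra_simps)

lemma card_f4: "card (UNIV :: f4 set) = 4"
proof -
  have "x \<in> {F4 False False, F4 False True, F4 True False, F4 True True}" for x
    by (cases x) auto
  then have "UNIV = {F4 False False, F4 False True, F4 True False, F4 True True}"
    by blast
  then have "card (UNIV :: f4 set) = card {F4 False False, F4 False True, F4 True False, F4 True True}"
    by (rule arg_cong)
  then show ?thesis by simp
qed

lemma card_skew: "card (carrier skew_ring) = 256"
proof -
  have "card prime_subfield = 2" by (simp add: prime_subfield_def)
  then show ?thesis
    by (simp add: skew_ring_def card_cartesian_product card_f4)
qed

text \<open>
  Below degree four the leading coefficients of two factors multiply without zero divisors, so a
  product vanishes only for trivial reasons or when the degrees add up to at least four. In degree
  four exactly, the two products are \<open>tr (u (frob v))\<close> and \<open>tr (v (frob u))\<close> (or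
  \<open>tr (u v)\<close> and \<open>tr (v u)\<close>), and these agree because the trace is invariant under \<open>frob\<close>.
\<close>
lemma reversible_skew:
  assumes "x \<in> carrier skew_ring" "y \<in> carrier skew_ring"
    "x \<otimes>\<^bsub>skew_ring\<^esub> y = \<zero>\<^bsub>skew_ring\<^esub>"
  shows "y \<otimes>\<^bsub>skew_ring\<^esub> x = \<zero>\<^bsub>skew_ring\<^esub>"
proof -
  have comm: "tr (u * frob v) = tr (v * frob u)" for u v
    using tr_simps(2)[of "u * frob v"] by (simp add: mult.commute del: tr_simps(2))
  obtain a0 a1 a2 a3 a4 b0 b1 b2 b3 b4
    where xy: "x = (a0, a1, a2, a3, a4)" "y = (b0, b1, b2, b3, b4)"
    by (metis prod_cases5)
  have eqs: "a0 * b0 = 0" "a0 * b1 + a1 * b0 = 0" "a0 * b2 + a1 * frob b1 + a2 * b0 = 0"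
    "a0 * b3 + a1 * frob b2 + a2 * b1 + a3 * b0 = 0"
    "a0 * b4 + tr (a1 * frob b3 + a2 * b2 + a3 * frob b1) + a4 * b0 = 0"
    using assms(3) by (simp_all add: xy skew_ring_def)
  consider "b0 = 0" "a0 \<noteq> 0" | "a0 = 0" "b0 \<noteq> 0" | "a0 = 0" "b0 = 0" "a1 \<noteq> 0"
    | "a0 = 0" "b0 = 0" "a1 = 0" "b1 = 0" | "a0 = 0" "b0 = 0" "a1 = 0" "b1 \<noteq> 0"
    using eqs(1) by (auto simp: f4_no_zero_divisors)
  then show ?thesis
  proof cases
    case 1
    then have "b1 = 0" "b2 = 0" "b3 = 0" "b4 = 0"
      using eqs by (simp_all add: f4_no_zero_divisors)
    with 1 show ?thesis by (simp add: xy skew_ring_def)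
  next
    case 2
    then have "a1 = 0" "a2 = 0" "a3 = 0" "a4 = 0"
      using eqs by (simp_all add: f4_no_zero_divisors)
    with 2 show ?thesis by (simp add: xy skew_ring_def)
  next
    case 3
    then have "b1 = 0" "b2 = 0"
      using eqs by (simp_all add: f4_no_zero_divisors)
    with 3 show ?thesis using eqs(5) comm[of b3 a1] by (simp add: xy skew_ring_def)
  next
    case 4
    with eqs(5) show ?thesis by (simp add: xy skew_ring_def mult.commute)
  next
    case 5
    then have "a2 = 0"
      using eqs(4) by (simp add: f4_no_zero_divisors)
    with 5 show ?thesis using eqs(5) comm[of b1 a3] by (simp add: xy skew_ring_def)
  qed
qed

text \<open>
  The products of \<open>x\<close>, \<open>\<omega> x\<close>, \<open>\<omega> x\<^sup>2\<close> in the two orders have top coefficients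
  \<open>tr (frob \<omega> \<omega>) = tr 1 = 0\<close> and \<open>tr (\<omega> \<omega>) = 1\<close>.
\<close>
lemma nonsymmetric_skew: "\<not> symmetric_ring skew_ring"
proof
  let ?w = "F4 False True"
  let ?x = "(0, 1, 0, 0, 0)" and ?y = "(0, ?w, 0, 0, 0)" and ?z = "(0, 0, ?w, 0, 0)"
  assume "symmetric_ring skew_ring"
  from symmetric_ring.symmetric[OF this, of ?x ?y ?z] show False
    by (simp add: skew_ring_def tr_def frob_def f4_defs prime_subfield_def)
qed

lemma exists_nat_copy:
  fixes R :: "'a ring" (structure)
  assumes "reversible_ring R" "finite (carrier R)" "\<not> symmetric_ring R"
  shows "\<exists>S :: nat ring. reversible_ring S \<and> finite (carrier S) \<and> order S = order R \<and> \<not> symmetric_ring S"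
proof -
  interpret reversible_ring R by fact
  obtain f :: "'a \<Rightarrow> nat" where f: "inj_on f (carrier R)"
    using finite_imp_inj_to_nat_seg[OF assms(2)] by blast
  define S where "S = image_ring f R"
  interpret S: ring S unfolding S_def by (rule inj_imp_image_ring_is_ring[OF f])
  have car: "carrier S = f ` carrier R" by (simp add: S_def image_ring_carrier)
  have mult: "f x \<otimes>\<^bsub>S\<^esub> f y = f (x \<otimes> y)" if "x \<in> carrier R" "y \<in> carrier R" for x y
    using that f by (simp add: S_def image_ring_def image_group_def monoid.defs)
  have zero: "f x = \<zero>\<^bsub>S\<^esub> \<longleftrightarrow> x = \<zero>" if "x \<in> carrier R" for x
    using that f by (simp add: S_def image_ring_zero inj_on_eq_iff)
  have "reversible_ring S"
    by unfold_locales (auto simp: car mult zero reversible)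
  moreover have "\<not> symmetric_ring S"
  proof
    assume "symmetric_ring S"
    then interpret S: symmetric_ring S .
    have "symmetric_ring R"
    proof
      fix a b c assume "a \<in> carrier R" "b \<in> carrier R" "c \<in> carrier R" "a \<otimes> b \<otimes> c = \<zero>"
      then show "b \<otimes> a \<otimes> c = \<zero>"
        using S.symmetric[of "f a" "f b" "f c"] by (simp add: car mult zero)
    qed
    with assms(3) show False ..
  qed
  moreover have "order S = order R" using f by (simp add: order_def car card_image)
  ultimately show ?thesis using assms(2) car by (intro exI[of _ S]) simp
qed

lemma reversible_nonsymmetric_256:
  "\<exists>R :: nat ring. reversible_ring R \<and> finite (carrier R) \<and> order R = 256 \<and> \<not> symmetric_ring R"
proof -
  have "reversible_ring skew_ring"
    by (simp add: reversible_ring_def reversible_ring_axioms_def ring_skew reversible_skew)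
  moreover have "finite (carrier skew_ring)"
    using card_skew card_ge_0_finite by force
  ultimately show ?thesis
    using exists_nat_copy[of skew_ring] nonsymmetric_skew card_skew by (simp add: order_def)
qed

section \<open>Indices of additive subgroups\<close>

context ring
begin

lemma additive_subgroup_multiple:
  assumes "additive_subgroup B R" "b \<in> B"
  shows "[(k::int)] \<cdot> b \<in> B"
proof -
  interpret B: additive_subgroup B R by fact
  have nat: "[(n::nat)] \<cdot> b \<in> B" for n
    by (induction n) (use assms(2) in auto)
  show ?thesis
    by (cases "k \<ge> 0") (simp_all add: add_pow_int_ge add_pow_int_lt nat)
qed

lemma additive_subgroup_diff:
  assumes "additive_subgroup B R" "x \<in> B" "y \<in> B"
  shows "x \<ominus> y \<in> B"
  using assms by (simp add: a_minus_def additive_subgroup.a_closed additive_subgroup.a_inv_closed)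

lemma diff_eq_diff_swap:
  assumes "a \<in> carrier R" "b \<in> carrier R" "c \<in> carrier R" "d \<in> carrier R" "a \<oplus> b = c \<oplus> d"
  shows "a \<ominus> c = d \<ominus> b"
proof -
  have "a \<ominus> c = (a \<oplus> b) \<ominus> b \<ominus> c" using assms(1-4) by algebra
  also have "\<dots> = d \<ominus> b" unfolding assms(5) using assms(1-4) by algebra
  finally show ?thesis .
qed

lemma coprime_multiple_cancel:
  assumes "additive_subgroup B R" "x \<in> carrier R" "[k] \<cdot> x \<in> B" "[l] \<cdot> x \<in> B" "coprime k (l::int)"
  shows "x \<in> B"
proof -
  obtain u v where uv: "k * u + l * v = 1"
    using bezout_int[of k l] assms(5) by (auto simp: coprime_iff_gcd_eq_1 mult.commute)
  have "x = [(k * u + l * v)] \<cdot> x" using uv assms(2) by simp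
  also have "\<dots> = [u] \<cdot> ([k] \<cdot> x) \<oplus> [v] \<cdot> ([l] \<cdot> x)"
    using assms(2) by (simp add: add.int_pow_mult add.int_pow_pow)
  also have "\<dots> \<in> B"
    by (simp add: additive_subgroup.a_closed[OF assms(1)] additive_subgroup_multiple[OF assms(1)]
        assms(3,4))
  finally show ?thesis .
qed

definition adjoin :: "'a \<Rightarrow> 'a set \<Rightarrow> 'a set" where
  "adjoin x B = {y. \<exists>k::int. \<exists>b\<in>B. y = [k] \<cdot> x \<oplus> b}"

lemma adjoin_subgroup:
  assumes "additive_subgroup B R" "x \<in> carrier R"
  shows "additive_subgroup (adjoin x B) R"
proof -
  interpret B: additive_subgroup B R by fact
  show ?thesis
  proof (intro additive_subgroupI add.subgroupI)
    show "adjoin x B \<subseteq> carrier R" using assms(2) by (auto simp: adjoin_def)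
    show "adjoin x B \<noteq> {}" by (auto simp: adjoin_def intro: B.zero_closed)
  next
    fix a assume "a \<in> adjoin x B"
    then obtain k b where "b \<in> B" "a = [(k::int)] \<cdot> x \<oplus> b" by (auto simp: adjoin_def)
    then have "\<ominus> a = [(- k)] \<cdot> x \<oplus> \<ominus> b" using assms(2) by (simp add: add.int_pow_neg minus_add)
    with \<open>b \<in> B\<close> show "\<ominus> a \<in> adjoin x B" by (auto simp: adjoin_def)
  next
    fix a a' assume "a \<in> adjoin x B" "a' \<in> adjoin x B"
    then obtain k b k' b' where "b \<in> B" "a = [(k::int)] \<cdot> x \<oplus> b"
      "b' \<in> B" "a' = [(k'::int)] \<cdot> x \<oplus> b'" by (auto simp: adjoin_def)
    then have "a \<oplus> a' = [(k + k')] \<cdot> x \<oplus> (b \<oplus> b')"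
      using assms(2) by (simp add: add.int_pow_mult a_ac)
    with \<open>b \<in> B\<close> \<open>b' \<in> B\<close> show "a \<oplus> a' \<in> adjoin x B" by (auto simp: adjoin_def)
  qed
qed

lemma adjoin_superset:
  assumes "additive_subgroup B R" "x \<in> carrier R"
  shows "B \<subseteq> adjoin x B" "x \<in> adjoin x B"
proof -
  interpret B: additive_subgroup B R by fact
  show "B \<subseteq> adjoin x B"
  proof
    fix b assume "b \<in> B"
    then show "b \<in> adjoin x B"
      unfolding adjoin_def by (intro CollectI exI[of _ 0] bexI[of _ b]) (auto simp: add_pow_def)
  qed
  show "x \<in> adjoin x B"
    unfolding adjoin_def using assms(2)
    by (intro CollectI exI[of _ 1] bexI[of _ "\<zero>"]) auto
qed

lemma adjoin_subset:
  assumes "additive_subgroup A R" "B \<subseteq> A" "x \<in> A"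
  shows "adjoin x B \<subseteq> A"
  using assms by (auto simp: adjoin_def additive_subgroup_multiple
      intro!: additive_subgroup.a_closed[OF assms(1)])

text \<open>
  Modulo \<open>B\<close> the element \<open>x\<close> has order \<open>p\<close>, so every element of the larger subgroup is
  \<open>[i] \<cdot> x \<oplus> b\<close> for a unique residue \<open>i\<close> below \<open>p\<close>.
\<close>
lemma card_adjoin:
  assumes B: "additive_subgroup B R" "finite B" and x: "x \<in> carrier R" "x \<notin> B"
    and p: "prime p" "[(int p)] \<cdot> x \<in> B"
  shows "card (adjoin x B) = p * card B"
proof -
  interpret B: additive_subgroup B R by fact
  let ?f = "\<lambda>(i, b). [i] \<cdot> x \<oplus> b"
  have "inj_on ?f ({0..<int p} \<times> B)"
  proof (rule inj_onI, clarify)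
    fix i j b c
    assume *: "i \<in> {0..<int p}" "j \<in> {0..<int p}" "b \<in> B" "c \<in> B" "[i] \<cdot> x \<oplus> b = [j] \<cdot> x \<oplus> c"
    have car: "[i] \<cdot> x \<in> carrier R" "[j] \<cdot> x \<in> carrier R" "b \<in> carrier R" "c \<in> carrier R"
      using x * by auto
    have "[(i - j)] \<cdot> x = [i] \<cdot> x \<ominus> [j] \<cdot> x"
      using x by (simp add: add.int_pow_diff a_minus_def)
    also have "\<dots> = c \<ominus> b" using diff_eq_diff_swap *(5) car by blast
    also have "\<dots> \<in> B" using additive_subgroup_diff[OF B(1)] * by simp
    finally have "\<not> coprime (i - j) (int p)"
      using coprime_multiple_cancel[OF B(1) x(1) _ p(2)] x(2) by blast
    then have "int p dvd i - j"
      using p(1) by (metis coprime_commute prime_imp_coprime prime_nat_int_transfer)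
    then have "i = j"
      using * by (metis atLeastLessThan_iff mod_eq_dvd_iff mod_pos_pos_trivial)
    then show "i = j \<and> b = c" using * car by simp
  qed
  moreover have "adjoin x B = ?f ` ({0..<int p} \<times> B)"
  proof
    show "adjoin x B \<subseteq> ?f ` ({0..<int p} \<times> B)"
    proof
      fix y assume "y \<in> adjoin x B"
      then obtain k b where y: "b \<in> B" "y = [(k::int)] \<cdot> x \<oplus> b" by (auto simp: adjoin_def)
      have "k = k mod int p + int p * (k div int p)" by simp
      then have "[k] \<cdot> x = [(k mod int p)] \<cdot> x \<oplus> [(k div int p)] \<cdot> ([(int p)] \<cdot> x)"
        by (metis add.int_pow_mult add.int_pow_pow x(1))
      then have "y = [(k mod int p)] \<cdot> x \<oplus> ([(k div int p)] \<cdot> ([(int p)] \<cdot> x) \<oplus> b)"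
        using x y by (simp add: a_assoc)
      moreover have "[(k div int p)] \<cdot> ([(int p)] \<cdot> x) \<oplus> b \<in> B"
        using y p additive_subgroup_multiple[OF B(1)] by blast
      moreover have "k mod int p \<in> {0..<int p}"
        using prime_gt_0_nat[OF p(1)] by simp
      ultimately show "y \<in> ?f ` ({0..<int p} \<times> B)" by force
    qed
  qed (auto simp: adjoin_def)
  ultimately show ?thesis
    by (simp add: card_image card_cartesian_product)
qed

text \<open>
  The quotient is a vector space over the prime field, and \<open>k\<close> is its dimension. It is found by
  adjoining elements of \<open>A\<close> to \<open>B\<close> until \<open>A\<close> is exhausted.
\<close>
lemma index_prime_power:
  assumes "prime p" "additive_subgroup A R" "finite A" "additive_subgroup B R" "B \<subseteq> A"
    "\<And>x. x \<in> A \<Longrightarrow> [(int p)] \<cdot> x \<in> B"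
  shows "\<exists>k. card A = p ^ k * card B"
  using assms(4-6)
proof (induction "card A - card B" arbitrary: B rule: less_induct)
  case less
  show ?case
  proof (cases "A = B")
    case True
    then show ?thesis by (intro exI[of _ 0]) simp
  next
    case False
    with less.prems obtain x where x: "x \<in> A" "x \<notin> B" by blast
    have car: "x \<in> carrier R" using additive_subgroup.a_subset[OF assms(2)] x by blast
    let ?C = "adjoin x B"
    have sub: "?C \<subseteq> A" using adjoin_subset[OF assms(2) less.prems(2) x(1)] .
    have "B \<subset> ?C" using adjoin_superset[OF less.prems(1) car] x by blast
    then have "card B < card ?C" 
      using assms(3) sub by (meson finite_subset psubset_card_mono)
    moreover have "card ?C \<le> card A" using sub assms(3) by (rule card_mono[rotated])
    ultimately have "card A - card ?C < card A - card B" by simp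
    from less.hyps[OF this] obtain k where "card A = p ^ k * card ?C"
      using adjoin_subgroup[OF less.prems(1) car] sub less.prems(3) \<open>B \<subset> ?C\<close> by blast
    also have "card ?C = p * card B"
      using card_adjoin[OF less.prems(1) _ car x(2) assms(1)] less.prems(2,3) x(1) assms(3)
      by (meson finite_subset)
    finally show ?thesis by (intro exI[of _ "Suc k"]) simp
  qed
qed

lemma adjoin_eqI:
  assumes "prime p" "additive_subgroup A R" "finite A" "additive_subgroup B R" "B \<subseteq> A"
    "card A = p * card B" "x \<in> A" "x \<notin> B" "[(int p)] \<cdot> x \<in> B"
  shows "A = adjoin x B"
proof -
  have car: "x \<in> carrier R" using additive_subgroup.a_subset[OF assms(2)] assms by blast
  show ?thesis
    using card_adjoin[OF assms(4) _ car assms(8,1,9)] adjoin_subset[OF assms(2,5,7)] assms(3,5,6)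
    by (metis card_subset_eq finite_subset)
qed

text \<open>
  Counting cosets without forming the quotient: pairwise incongruent elements lie in disjoint
  cosets.
\<close>
lemma card_ge_incongruent:
  assumes "additive_subgroup A R" "finite A" "additive_subgroup B R" "B \<subseteq> A" "D \<subseteq> A"
    "\<And>d d'. d \<in> D \<Longrightarrow> d' \<in> D \<Longrightarrow> d \<ominus> d' \<in> B \<Longrightarrow> d = d'"
  shows "card D * card B \<le> card A"
proof -
  have "inj_on (\<lambda>(d, b). d \<oplus> b) (D \<times> B)"
  proof (rule inj_onI, clarify)
    fix d b d' b' assume *: "d \<in> D" "b \<in> B" "d' \<in> D" "b' \<in> B" "d \<oplus> b = d' \<oplus> b'"
    have car: "d \<in> carrier R" "d' \<in> carrier R" "b \<in> carrier R" "b' \<in> carrier R"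
      using * assms additive_subgroup.a_subset by blast+
    have "d \<ominus> d' = b' \<ominus> b" using diff_eq_diff_swap *(5) car by blast
    then have "d = d'"
      using * assms(6) additive_subgroup_diff[OF assms(3)] by metis
    then show "d = d' \<and> b = b'" using * car by simp
  qed
  moreover have "(\<lambda>(d, b). d \<oplus> b) ` (D \<times> B) \<subseteq> A"
    using assms by (auto intro!: additive_subgroup.a_closed[OF assms(1)])
  ultimately have "card (D \<times> B) \<le> card A"
    using assms(2) card_inj_on_le by blast
  then show ?thesis by (simp add: card_cartesian_product)
qed

end

section \<open>Nilpotent filtrations in reversible rings\<close>

context ring
begin

lemma additive_subgroup_left_quotient:
  assumes "additive_subgroup P R" "u \<in> carrier R"
  shows "additive_subgroup {t \<in> carrier R. u \<otimes> t \<in> P} R"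
proof -
  interpret P: additive_subgroup P R by fact
  show ?thesis
    using assms(2)
    by (intro additive_subgroupI add.subgroupI) (auto simp: r_distr r_minus)
qed

lemma additive_subgroup_right_quotient:
  assumes "additive_subgroup P R" "u \<in> carrier R"
  shows "additive_subgroup {t \<in> carrier R. t \<otimes> u \<in> P} R"
proof -
  interpret P: additive_subgroup P R by fact
  show ?thesis
    using assms(2)
    by (intro additive_subgroupI add.subgroupI) (auto simp: l_distr l_minus)
qed

lemma additive_subgroup_left_multiples:
  assumes "additive_subgroup P R" "u \<in> carrier R"
  shows "additive_subgroup ((\<otimes>) u ` P) R"
proof -
  interpret P: additive_subgroup P R by fact
  show ?thesis
  proof (intro additive_subgroupI add.subgroupI)
    show "(\<otimes>) u ` P \<noteq> {}" using P.zero_closed by blast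
  next
    fix a assume "a \<in> (\<otimes>) u ` P"
    then show "\<ominus> a \<in> (\<otimes>) u ` P"
      using assms(2) by (auto simp: r_minus[symmetric])
  next
    fix a b assume "a \<in> (\<otimes>) u ` P" "b \<in> (\<otimes>) u ` P"
    then show "a \<oplus> b \<in> (\<otimes>) u ` P"
      using assms(2) by (auto simp: r_distr[symmetric])
  qed (use assms(2) in auto)
qed

lemma additive_subgroup_centralizer:
  assumes "S \<subseteq> carrier R"
  shows "additive_subgroup {t \<in> carrier R. \<forall>s\<in>S. t \<otimes> s = s \<otimes> t} R"
  using assms
  by (intro additive_subgroupI add.subgroupI) (auto simp: l_distr r_distr l_minus r_minus subset_iff)

lemma additive_subgroup_reversal:
  assumes "v \<in> carrier R" "w \<in> carrier R"
  shows "additive_subgroup {t \<in> carrier R. t \<otimes> v \<otimes> w = w \<otimes> v \<otimes> t} R"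
    "additive_subgroup {t \<in> carrier R. v \<otimes> t \<otimes> w = w \<otimes> t \<otimes> v} R"
    "additive_subgroup {t \<in> carrier R. v \<otimes> w \<otimes> t = t \<otimes> w \<otimes> v} R"
  using assms
  by (auto intro!: additive_subgroupI add.subgroupI simp: l_distr r_distr l_minus r_minus)

text \<open>
  Reversal of triple products is additive in each factor, so it may be tested on any set that
  generates the factors additively.
\<close>
lemma triple_reversal_span:
  assumes span: "\<And>P. additive_subgroup P R \<Longrightarrow> X \<subseteq> P \<Longrightarrow> A \<subseteq> P"
    and X: "X \<subseteq> carrier R" "\<And>u v w. \<lbrakk>u \<in> X; v \<in> X; w \<in> X\<rbrakk> \<Longrightarrow> u \<otimes> v \<otimes> w = w \<otimes> v \<otimes> u"
    and abc: "a \<in> A" "b \<in> A" "c \<in> A"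
  shows "a \<otimes> b \<otimes> c = c \<otimes> b \<otimes> a"
proof -
  have A: "A \<subseteq> carrier R"
    using span[of "carrier R"] X(1) by (simp add: additive_subgroup.intro add.subgroup_self)
  have 1: "a' \<otimes> v \<otimes> w = w \<otimes> v \<otimes> a'" if "a' \<in> A" "v \<in> X" "w \<in> X" for a' v w
    using span[OF additive_subgroup_reversal(1)[of v w]] X that by blast
  have 2: "a' \<otimes> b' \<otimes> w = w \<otimes> b' \<otimes> a'" if "a' \<in> A" "b' \<in> A" "w \<in> X" for a' b' w
    using span[OF additive_subgroup_reversal(2)[of a' w]] X(1) A 1 that by blast
  show ?thesis
    using span[OF additive_subgroup_reversal(3)[of a b]] X(1) A 2 abc by blast
qed

end

context reversible_ring
begin

text \<open>
  From \<open>a b = 0\<close> one gets \<open>b a = 0\<close>, hence \<open>(u b) a = 0\<close>, and reversing again gives \<open>a (u b) = 0\<close>.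
\<close>
lemma zero_insert:
  assumes "a \<in> carrier R" "b \<in> carrier R" "u \<in> carrier R" "a \<otimes> b = \<zero>"
  shows "a \<otimes> u \<otimes> b = \<zero>"
proof -
  have "u \<otimes> b \<otimes> a = \<zero>" using assms reversible[of a b] by (simp add: m_assoc)
  then show ?thesis using assms reversible[of "u \<otimes> b" a] by (simp add: m_assoc)
qed

lemma zero_rotate:
  assumes "a \<in> carrier R" "b \<in> carrier R" "c \<in> carrier R" "a \<otimes> b \<otimes> c = \<zero>"
  shows "b \<otimes> c \<otimes> a = \<zero>" "c \<otimes> a \<otimes> b = \<zero>"
  using assms reversible[of a "b \<otimes> c"] reversible[of "a \<otimes> b" c] by (simp_all add: m_assoc)

end

text \<open>
  The abstract form of the powers of a nilpotent ideal \<open>J 1\<close> containing the prime \<open>p\<close>: consecutive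
  quotients are vector spaces over the prime field (\<open>p_multiple\<close>) and each term is spanned by
  products from earlier terms (\<open>J_span\<close>). The terms need not be ideals of the whole ring, which
  makes it possible to work inside a subring with prime residue field.
\<close>
locale nilpotent_filtration = reversible_ring R for R (structure) +
  fixes p :: nat and J :: "nat \<Rightarrow> 'a set" and m :: nat
  assumes finite_carrier: "finite (carrier R)"
    and prime_p: "prime p"
    and J_subgroup: "additive_subgroup (J k) R"
    and J_mult: "\<lbrakk>x \<in> J i; y \<in> J j\<rbrakk> \<Longrightarrow> x \<otimes> y \<in> J (i + j)"
    and J_Suc: "J (Suc k) \<subseteq> J k"
    and J_span: "\<lbrakk>additive_subgroup P R; \<And>u v. \<lbrakk>u \<in> J i; v \<in> J j\<rbrakk> \<Longrightarrow> u \<otimes> v \<in> P\<rbrakk> \<Longrightarrow> J (i + j) \<subseteq> P"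
    and p_multiple: "\<lbrakk>0 < k; x \<in> J k\<rbrakk> \<Longrightarrow> [(int p)] \<cdot> x \<in> J (Suc k)"
    and J_nilpotent: "J m = {\<zero>}"
begin

lemma J_carrier: "x \<in> J k \<Longrightarrow> x \<in> carrier R"
  using additive_subgroup.a_subset[OF J_subgroup] by blast

lemma J_antimono: "i \<le> j \<Longrightarrow> J j \<subseteq> J i"
  by (rule lift_Suc_antimono_le[of J]) (use J_Suc in auto)

lemma J_finite: "finite (J k)"
  using finite_subset[OF additive_subgroup.a_subset[OF J_subgroup] finite_carrier] .

lemmas J_add = additive_subgroup.a_closed[OF J_subgroup]
lemmas J_zero = additive_subgroup.zero_closed[OF J_subgroup]
lemmas J_minus = additive_subgroup.a_inv_closed[OF J_subgroup]
lemmas J_diff = additive_subgroup_diff[OF J_subgroup]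
lemmas J_multiple = additive_subgroup_multiple[OF J_subgroup]

lemma J_card_pos: "0 < card (J k)"
  using J_finite J_zero by (metis card_gt_0_iff empty_iff)

lemma J_prod:
  "\<lbrakk>u \<in> J 1; v \<in> J 1\<rbrakk> \<Longrightarrow> u \<otimes> v \<in> J 2"
  "\<lbrakk>u \<in> J 1; v \<in> J 2\<rbrakk> \<Longrightarrow> u \<otimes> v \<in> J 3"
  "\<lbrakk>u \<in> J 2; v \<in> J 1\<rbrakk> \<Longrightarrow> u \<otimes> v \<in> J 3"
  "\<lbrakk>u \<in> J 1; v \<in> J 3\<rbrakk> \<Longrightarrow> u \<otimes> v \<in> J 4"
  "\<lbrakk>u \<in> J 2; v \<in> J 2\<rbrakk> \<Longrightarrow> u \<otimes> v \<in> J 4"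
  "\<lbrakk>u \<in> J 3; v \<in> J 1\<rbrakk> \<Longrightarrow> u \<otimes> v \<in> J 4"
  "\<lbrakk>u \<in> J 4; v \<in> J 1\<rbrakk> \<Longrightarrow> u \<otimes> v \<in> J 5"
  "\<lbrakk>u \<in> J 1; v \<in> J 4\<rbrakk> \<Longrightarrow> u \<otimes> v \<in> J 5"
  "\<lbrakk>u \<in> J 2; v \<in> J 3\<rbrakk> \<Longrightarrow> u \<otimes> v \<in> J 5"
  "\<lbrakk>u \<in> J 3; v \<in> J 2\<rbrakk> \<Longrightarrow> u \<otimes> v \<in> J 5"
  using J_mult[of u 1 v 1] J_mult[of u 1 v 2] J_mult[of u 2 v 1] J_mult[of u 1 v 3]
    J_mult[of u 2 v 2] J_mult[of u 3 v 1] J_mult[of u 4 v 1] J_mult[of u 1 v 4] 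
    J_mult[of u 2 v 3] J_mult[of u 3 v 2]
  by (simp_all add: numeral_eq_Suc)

lemma J_span2: "\<lbrakk>additive_subgroup P R; \<And>u v. \<lbrakk>u \<in> J 1; v \<in> J 1\<rbrakk> \<Longrightarrow> u \<otimes> v \<in> P\<rbrakk> \<Longrightarrow> J 2 \<subseteq> P"
  using J_span[of P 1 1] by (simp add: numeral_eq_Suc)

lemma J_span3:
  assumes "additive_subgroup P R" "\<And>u v w. \<lbrakk>u \<in> J 1; v \<in> J 1; w \<in> J 1\<rbrakk> \<Longrightarrow> u \<otimes> v \<otimes> w \<in> P"
  shows "J 3 \<subseteq> P"
proof -
  have "J 2 \<subseteq> {t \<in> carrier R. t \<otimes> w \<in> P}" if "w \<in> J 1" for w
    using assms that J_carrier[of _ 1]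
    by (intro J_span2 additive_subgroup_right_quotient) auto
  then show ?thesis using J_span[of P 2 1] assms(1) by (auto simp: numeral_eq_Suc)
qed

lemma J_span4:
  assumes "additive_subgroup P R"
    "\<And>u v w z. \<lbrakk>u \<in> J 1; v \<in> J 1; w \<in> J 1; z \<in> J 1\<rbrakk> \<Longrightarrow> u \<otimes> v \<otimes> w \<otimes> z \<in> P"
  shows "J 4 \<subseteq> P"
proof -
  have "J 3 \<subseteq> {t \<in> carrier R. t \<otimes> w \<in> P}" if "w \<in> J 1" for w
    using assms that J_carrier[of _ 1]
    by (intro J_span3 additive_subgroup_right_quotient) auto
  then show ?thesis using J_span[of P 3 1] assms(1) by (auto simp: numeral_eq_Suc)
qed

text \<open>
  A repetition propagates through \<open>J_span\<close> to all later terms, and these are eventually zero.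
\<close>
lemma J_stationary_zero:
  assumes "J (Suc k) = J k"
  shows "J k = {\<zero>}"
proof -
  have "J k = J (k + i)" for i
  proof (induction i)
    case (Suc i)
    have "J (k + i) \<subseteq> J (k + Suc i)"
      by (rule J_span[OF J_subgroup]) (use assms J_mult[of _ "Suc k"] in auto)
    then show ?case using Suc J_Suc[of "k + i"] by auto
  qed simp
  then have "J k = J (k + m)" .
  then have "J k \<subseteq> {\<zero>}" using J_antimono[of m "k + m"] J_nilpotent by simp
  then show ?thesis using J_zero by blast
qed

lemma J_index:
  assumes "0 < k"
  shows "\<exists>n. card (J k) = p ^ n * card (J (Suc k))"
  using index_prime_power[OF prime_p J_subgroup J_finite J_subgroup J_Suc] p_multiple[OF assms] .

lemma J_index_pos:
  assumes "0 < k" "J k \<noteq> {\<zero>}"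
  shows "\<exists>n>0. card (J k) = p ^ n * card (J (Suc k))"
proof -
  obtain n where n: "card (J k) = p ^ n * card (J (Suc k))" using J_index[OF assms(1)] ..
  have "n \<noteq> 0"
  proof
    assume "n = 0"
    then have "J (Suc k) = J k" using n J_Suc J_finite by (simp add: card_subset_eq)
    with J_stationary_zero assms(2) show False by blast
  qed
  with n show ?thesis by blast
qed

lemma J_adjoin:
  assumes "0 < k" "card (J k) = p * card (J (Suc k))" "x \<in> J k" "x \<notin> J (Suc k)"
  shows "J k = adjoin x (J (Suc k))"
  using adjoin_eqI[OF prime_p J_subgroup J_finite J_subgroup J_Suc assms(2-4)] p_multiple assms
  by blast

lemma adjoin_mult_mem:
  assumes "u \<in> J i" "v \<in> J j" "s \<in> adjoin u (J (Suc i))" "t \<in> adjoin v (J (Suc j))"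
  shows "s \<otimes> t \<in> adjoin (u \<otimes> v) (J (Suc (i + j)))"
proof -
  obtain k s' where s: "s' \<in> J (Suc i)" "s = [(k::int)] \<cdot> u \<oplus> s'"
    using assms(3) by (auto simp: adjoin_def)
  obtain l t' where t: "t' \<in> J (Suc j)" "t = [(l::int)] \<cdot> v \<oplus> t'"
    using assms(4) by (auto simp: adjoin_def)
  have car: "u \<in> carrier R" "v \<in> carrier R" "s' \<in> carrier R" "t' \<in> carrier R"
    using assms s t J_carrier by auto
  have "(x \<oplus> s') \<otimes> (y \<oplus> t') = x \<otimes> y \<oplus> (x \<otimes> t' \<oplus> (s' \<otimes> y \<oplus> s' \<otimes> t'))"
    if "x \<in> carrier R" "y \<in> carrier R" for x y
    using that car by algebra
  from this[of "[k] \<cdot> u" "[l] \<cdot> v"]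
  have "s \<otimes> t = [(l * k)] \<cdot> (u \<otimes> v) \<oplus> ([k] \<cdot> (u \<otimes> t') \<oplus> ([l] \<cdot> (s' \<otimes> v) \<oplus> s' \<otimes> t'))"
    using car by (simp add: s t add_pow_ldistr_int add_pow_rdistr_int add.int_pow_pow mult.commute)
  moreover have "u \<otimes> t' \<in> J (Suc (i + j))" using J_mult[OF assms(1) t(1)] by simp
  moreover have "s' \<otimes> v \<in> J (Suc (i + j))" using J_mult[OF s(1) assms(2)] by simp
  moreover have "s' \<otimes> t' \<in> J (Suc (i + j))"
    using J_mult[OF s(1) t(1)] J_antimono[of "Suc (i + j)" "Suc i + Suc j"] by auto
  ultimately show ?thesis
    unfolding adjoin_def by (blast intro: J_add J_multiple)
qed

lemma J_add_adjoin:
  assumes "u \<in> J i" "v \<in> J j" "J i = adjoin u (J (Suc i))" "J j = adjoin v (J (Suc j))"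
  shows "J (i + j) = adjoin (u \<otimes> v) (J (Suc (i + j)))"
proof
  show "J (i + j) \<subseteq> adjoin (u \<otimes> v) (J (Suc (i + j)))"
    using assms adjoin_mult_mem J_carrier[OF assms(1)] J_carrier[OF assms(2)]
    by (intro J_span adjoin_subgroup[OF J_subgroup]) auto
  show "adjoin (u \<otimes> v) (J (Suc (i + j))) \<subseteq> J (i + j)"
    using assms by (intro adjoin_subset J_subgroup J_Suc J_mult)
qed

lemma J_power: "x \<in> J 1 \<Longrightarrow> 0 < k \<Longrightarrow> x [^] k \<in> J k"
proof (induction k)
  case (Suc k)
  show ?case
  proof (cases "k = 0")
    case True
    then show ?thesis using Suc J_carrier by simp
  next
    case False
    then show ?thesis using Suc J_mult[of "x [^] k" k x 1] by simp
  qed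
qed simp

text \<open>
  Downward induction from the vanishing term: each \<open>J k\<close> is generated over the next one by a power
  of \<open>x\<close>, so \<open>J n\<close> consists of integral combinations of powers of \<open>x\<close>.
\<close>
lemma J_subset_of_powers:
  assumes "additive_subgroup P R" "\<And>k. n \<le> k \<Longrightarrow> J k = adjoin (x [^] k) (J (Suc k))"
    "\<And>k. n \<le> k \<Longrightarrow> x [^] k \<in> P"
  shows "J n \<subseteq> P"
proof -
  have "J (m + n - i) \<subseteq> P" if "i \<le> m" for i
    using that
  proof (induction i)
    case 0
    have "J (m + n) \<subseteq> {\<zero>}" using J_antimono[of m "m + n"] J_nilpotent by simp
    then show ?case using additive_subgroup.zero_closed[OF assms(1)] by auto
  next
    case (Suc i)
    let ?k = "m + n - Suc i"
    have "n \<le> ?k" "Suc ?k = m + n - i" using Suc.prems by auto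
    then show ?case
      using assms(2)[of ?k] adjoin_subset[OF assms(1), of "J (Suc ?k)"] assms(3)[of ?k] Suc by simp
  qed
  from this[of m] show ?thesis by simp
qed

text \<open>
  Integral combinations of powers of \<open>x\<close> commute. This is phrased with centralizers, which are
  additive subgroups containing the powers, so that no polynomial expressions are needed.
\<close>
lemma J_commute_of_powers:
  assumes "x \<in> J 1" "\<And>k. n \<le> k \<Longrightarrow> J k = adjoin (x [^] k) (J (Suc k))"
    "a \<in> J n" "b \<in> J n"
  shows "a \<otimes> x = x \<otimes> a" "a \<otimes> b = b \<otimes> a"
proof -
  have x: "x \<in> carrier R" using assms J_carrier by blast
  have comm: "t \<otimes> x = x \<otimes> t" if "t \<in> J n" for t
  proof -
    have "J n \<subseteq> {t \<in> carrier R. \<forall>s\<in>{x}. t \<otimes> s = s \<otimes> t}"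
      using x by (intro J_subset_of_powers[OF additive_subgroup_centralizer assms(2)])
        (auto simp: nat_pow_comm[of x _ 1, simplified])
    with that show ?thesis by blast
  qed
  then show "a \<otimes> x = x \<otimes> a" using assms by blast
  have pow: "x [^] k \<otimes> t = t \<otimes> x [^] k" if t: "t \<in> J n" for t and k :: nat
  proof (induction k)
    case (Suc k)
    have tc: "t \<in> carrier R" using t J_carrier by blast
    have "x [^] Suc k \<otimes> t = x [^] k \<otimes> (t \<otimes> x)" using comm[OF t] x tc by (simp add: m_assoc)
    also have "\<dots> = (t \<otimes> x [^] k) \<otimes> x" using Suc x tc by (simp flip: m_assoc)
    finally show ?case using x tc by (simp add: m_assoc)
  qed (use J_carrier[OF t] in simp)
  have "J n \<subseteq> {t \<in> carrier R. \<forall>s\<in>J n. t \<otimes> s = s \<otimes> t}"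
    using x pow J_carrier
    by (intro J_subset_of_powers[OF additive_subgroup_centralizer assms(2)]) auto
  with assms show "a \<otimes> b = b \<otimes> a" by blast
qed

text \<open>
  If the first quotient is one-dimensional then \<open>J 1\<close> is generated by the powers of a single element.
\<close>
theorem cyclic_top_commutative:
  assumes "card (J 1) = p * card (J 2)" "a \<in> J 1" "b \<in> J 1"
  shows "a \<otimes> b = b \<otimes> a"
proof -
  have "J 1 \<noteq> J 2" 
    using assms(1) J_card_pos[of 2] prime_gt_1_nat[OF prime_p] by auto
  then obtain x where x: "x \<in> J 1" "x \<notin> J 2" using J_Suc[of 1] by (auto simp: numeral_2_eq_2)
  have 1: "J 1 = adjoin x (J (Suc 1))"
    using assms(1) x by (intro J_adjoin) (simp_all add: numeral_2_eq_2)
  have "J k = adjoin (x [^] k) (J (Suc k))" if "1 \<le> k" for k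
    using that
  proof (induction k rule: dec_induct)
    case base
    then show ?case using 1 J_carrier[OF x(1)] by (simp add: nat_pow_def)
  next
    case (step k)
    then show ?case using J_add_adjoin[of "x [^] k" k x 1] J_power[OF x(1), of k] x 1 by simp
  qed
  from J_commute_of_powers(2)[OF x(1) this assms(2,3)] show ?thesis .
qed

end

section \<open>One-dimensional second quotient\<close>

context nilpotent_filtration
begin

text \<open>
  Suppose the second quotient is one-dimensional. Choose a triple product \<open>u v x\<close> outside \<open>J 4\<close>.
  Any product of two factors outside \<open>J 3\<close> generates \<open>J 2\<close> modulo \<open>J 3\<close>, so \<open>u v\<close> may be
  traded for \<open>v x\<close> and this for \<open>x x\<close>; hence \<open>x\<^sup>3\<close> lies outside \<open>J 4\<close>, and from
  the second term on the filtration is generated by the powers of \<open>x\<close>. As \<open>x J 1\<close> lies in \<open>J 2\<close>,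
  which is spanned by \<open>x\<^sup>2\<close> and \<open>x J 2\<close>, every element of \<open>J 1\<close> is a combination of powers
  of \<open>x\<close> plus an element \<open>w\<close> with \<open>x w = 0\<close>. The first kind commute with each other and
  annihilate the second kind on both sides. A product of two elements of the second kind lies in \<open>J 2\<close>,
  which is contained in \<open>x J 1\<close>, so it annihilates a third. Thus triple products only see the
  commuting parts.
\<close>
theorem cyclic_square_reversal:
  assumes card2: "card (J 2) = p * card (J 3)" and J3: "J 3 \<noteq> {\<zero>}"
    and abc: "a \<in> J 1" "b \<in> J 1" "c \<in> J 1"
  shows "a \<otimes> b \<otimes> c = c \<otimes> b \<otimes> a"
proof -
  have J34: "\<not> J 3 \<subseteq> J 4" 
    using J3 J_stationary_zero[of 3] J_Suc[of 3] by (auto simp: numeral_eq_Suc)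
  have gen: "J 2 = adjoin s (J 3)" if "s \<in> J 2" "s \<notin> J 3" for s
    using J_adjoin[of 2 s] that card2 by (simp add: numeral_eq_Suc)
  obtain u v x where uvx: "u \<in> J 1" "v \<in> J 1" "x \<in> J 1" "u \<otimes> v \<otimes> x \<notin> J 4"
    using J_span3[OF J_subgroup[of 4]] J34 by blast
  have car: "u \<in> carrier R" "v \<in> carrier R" "x \<in> carrier R" using uvx J_carrier by blast+
  \<comment> \<open>shifting the factors of a nonzero product to the left turns it into a power of the last factor\<close>
  have shift: "v' \<otimes> x \<otimes> x \<notin> J 4"
    if "u' \<in> J 1" "v' \<in> J 1" "u' \<otimes> v' \<otimes> x \<notin> J 4" for u' v'
  proof
    assume vxx: "v' \<otimes> x \<otimes> x \<in> J 4"
    have car': "u' \<in> carrier R" "v' \<in> carrier R" using that J_carrier by blast+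
    have "v' \<otimes> x \<notin> J 3"
      using that J_prod(4)[of u' "v' \<otimes> x"] car car' by (auto simp: m_assoc)
    then have "J 2 = adjoin (v' \<otimes> x) (J 3)" using gen J_prod(1) that uvx by blast
    then have "u' \<otimes> v' \<in> adjoin (v' \<otimes> x) (J 3)" using J_prod(1) that by blast
    then obtain k t where t: "t \<in> J 3" "u' \<otimes> v' = [(k::int)] \<cdot> (v' \<otimes> x) \<oplus> t"
      by (auto simp: adjoin_def)
    have "u' \<otimes> v' \<otimes> x = [k] \<cdot> (v' \<otimes> x \<otimes> x) \<oplus> t \<otimes> x"
      using t car car' J_carrier[OF t(1)] by (simp add: l_distr add_pow_ldistr_int)
    also have "\<dots> \<in> J 4"
      using vxx J_prod(6)[OF t(1) uvx(3)] by (intro J_add J_multiple)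
    finally show False using that by blast
  qed
  have xxx: "x \<otimes> x \<otimes> x \<notin> J 4" using shift[OF uvx(2,3)] shift[OF uvx(1,2,4)] by blast
  have xx: "x \<otimes> x \<in> J 2" using J_prod(1) uvx by blast
  have "x \<otimes> x \<notin> J 3" using xxx J_prod(6) uvx by blast
  then have gen2: "J 2 = adjoin (x \<otimes> x) (J 3)" using gen xx by blast
  have gen3: "J 3 = adjoin (x \<otimes> x \<otimes> x) (J 4)"
  proof
    show "adjoin (x \<otimes> x \<otimes> x) (J 4) \<subseteq> J 3"
      using J_subgroup J_antimono[of 3 4] J_prod(3)[OF xx uvx(3)] by (intro adjoin_subset) auto
    have "J (2 + 1) \<subseteq> adjoin (x \<otimes> x \<otimes> x) (J 4)"
    proof (rule J_span)
      show sub: "additive_subgroup (adjoin (x \<otimes> x \<otimes> x) (J 4)) R"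
        using adjoin_subgroup[OF J_subgroup] car by simp
      fix s y assume "s \<in> J 2" and y: "y \<in> J 1"
      then obtain k t where t: "t \<in> J 3" "s = [(k::int)] \<cdot> (x \<otimes> x) \<oplus> t"
        using gen2 by (auto simp: adjoin_def)
      obtain l t' where t': "t' \<in> J 3" "x \<otimes> y = [(l::int)] \<cdot> (x \<otimes> x) \<oplus> t'"
        using J_prod(1)[OF uvx(3) y] gen2 by (auto simp: adjoin_def)
      have c: "y \<in> carrier R" "t \<in> carrier R" "t' \<in> carrier R" using y t t' J_carrier by blast+
      have "x \<otimes> x \<otimes> y = [l] \<cdot> (x \<otimes> x \<otimes> x) \<oplus> x \<otimes> t'"
        using c car t'(2) by (simp add: m_assoc r_distr add_pow_rdistr_int)
      then have "x \<otimes> x \<otimes> y \<in> adjoin (x \<otimes> x \<otimes> x) (J 4)"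
        using J_prod(4)[OF uvx(3) t'(1)] by (auto simp: adjoin_def)
      moreover have "s \<otimes> y = [k] \<cdot> (x \<otimes> x \<otimes> y) \<oplus> t \<otimes> y"
        using c car t by (simp add: l_distr add_pow_ldistr_int)
      moreover have "t \<otimes> y \<in> adjoin (x \<otimes> x \<otimes> x) (J 4)"
        using adjoin_superset(1)[OF J_subgroup] car J_prod(6)[OF t(1) y] by blast
      ultimately show "s \<otimes> y \<in> adjoin (x \<otimes> x \<otimes> x) (J 4)"
        using additive_subgroup.a_closed[OF sub] additive_subgroup_multiple[OF sub] by simp
    qed
    then show "J 3 \<subseteq> adjoin (x \<otimes> x \<otimes> x) (J 4)" by simp
  qed
  have pow2: "x [^] (2::nat) = x \<otimes> x" using car by (simp add: numeral_2_eq_2)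
  have pow3: "x [^] (3::nat) = x \<otimes> x \<otimes> x" using car by (simp add: numeral_3_eq_3)
  have Suc23: "Suc 2 = 3" "Suc 3 = 4" by simp_all
  have powers: "J k = adjoin (x [^] k) (J (Suc k))" if "2 \<le> k" for k
    using that
  proof (induction k rule: less_induct)
    case (less k)
    consider "k = 2" | "k = 3" | "4 \<le> k" using less.prems by linarith
    then show ?case
    proof cases
      case 1
      have "J 2 = adjoin (x [^] (2::nat)) (J (Suc 2))" unfolding pow2 Suc23 by (rule gen2)
      with 1 show ?thesis by (simp only:)
    next
      case 2
      have "J 3 = adjoin (x [^] (3::nat)) (J (Suc 3))" unfolding pow3 Suc23 by (rule gen3)
      with 2 show ?thesis by (simp only:)
    next
      case 3
      define j where "j = k - 2"
      with 3 have j: "k = 2 + j" "2 \<le> j" by simp_all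
      have "J j = adjoin (x [^] j) (J (Suc j))" by (rule less.IH) (use j in auto)
      then have "J (2 + j) = adjoin (x \<otimes> x \<otimes> x [^] j) (J (Suc (2 + j)))"
        using gen2 xx J_power[OF uvx(3), of j] j(2) by (intro J_add_adjoin) (simp_all add: Suc23)
      moreover have "x \<otimes> x \<otimes> x [^] j = x [^] k"
        using car j nat_pow_mult[of x 2 j] by (simp add: pow2)
      ultimately show ?thesis using j by simp
    qed
  qed
  note comm = J_commute_of_powers[OF uvx(3) powers]
  have sub_left: "J (Suc n) \<subseteq> (\<otimes>) x ` J n" if "0 < n" for n
  proof (intro J_subset_of_powers[of _ _ x])
    fix k assume k: "Suc n \<le> k"
    then show "J k = adjoin (x [^] k) (J (Suc k))" using that by (intro powers) simp
    from k that obtain j where j: "k = Suc j" "0 < j" "n \<le> j" by (cases k) auto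
    have "x [^] j \<in> J n" using J_power[OF uvx(3) j(2)] J_antimono[OF j(3)] by auto
    then show "x [^] k \<in> (\<otimes>) x ` J n" using nat_pow_Suc2[OF car(3)] j by auto
  qed (use additive_subgroup_left_multiples J_subgroup car in blast)
  define W where "W = {w \<in> J 1. x \<otimes> w = \<zero>}"
  have kill: "s \<otimes> w = \<zero>" "w \<otimes> s = \<zero>" if "s \<in> insert x (J 2)" "w \<in> W" for s w
  proof -
    have w: "w \<in> carrier R" "x \<otimes> w = \<zero>" using that J_carrier by (auto simp: W_def)
    obtain g where g: "g \<in> carrier R" "s = x \<otimes> g"
    proof (cases "s = x")
      case True
      then show thesis using that[of \<one>] car by simp
    next
      case False
      then have "s \<in> J (Suc 1)" using \<open>s \<in> insert x (J 2)\<close> by (simp add: numeral_2_eq_2)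
      then obtain g where "g \<in> J 1" "s = x \<otimes> g" using sub_left[of 1] by auto
      then show thesis using that[of g] J_carrier by blast
    qed
    then show "s \<otimes> w = \<zero>" using zero_insert[OF car(3) w(1) g(1) w(2)] by simp
    then show "w \<otimes> s = \<zero>" using reversible[of s w] w(1) g car by simp
  qed
  show ?thesis
  proof (rule triple_reversal_span[where X = "insert x (J 2) \<union> W" and A = "J 1"])
    show "insert x (J 2) \<union> W \<subseteq> carrier R" using car J_carrier by (auto simp: W_def)
  next
    fix P assume P: "additive_subgroup P R" "insert x (J 2) \<union> W \<subseteq> P"
    show "J 1 \<subseteq> P"
    proof
      fix y assume y: "y \<in> J 1"
      obtain k t where t: "t \<in> J 3" "x \<otimes> y = [(k::int)] \<cdot> (x \<otimes> x) \<oplus> t"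
        using J_prod(1)[OF uvx(3) y] gen2 by (auto simp: adjoin_def)
      obtain s where s: "s \<in> J 2" "t = x \<otimes> s"
        using sub_left[of 2] t(1) by (auto simp: numeral_eq_Suc)
      have c: "y \<in> carrier R" "s \<in> carrier R" using y s J_carrier by blast+
      define f where "f = [k] \<cdot> x \<oplus> s"
      have f: "f \<in> carrier R" "f \<in> J 1" "f \<in> P"
        using c car s J_antimono[of 1 2] uvx(3) P(2)
          additive_subgroup.a_closed[OF P(1)] additive_subgroup_multiple[OF P(1)]
        by (auto simp: f_def intro!: J_add J_multiple)
      have "x \<otimes> f = x \<otimes> y"
        unfolding t(2) using c car s by (simp add: f_def r_distr add_pow_rdistr_int)
      then have "x \<otimes> (y \<ominus> f) = \<zero>"
        using f(1) c car by (simp add: a_minus_def r_distr r_minus r_neg)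
      then have "y \<ominus> f \<in> P" using P(2) J_diff[OF y f(2)] by (auto simp: W_def)
      then have "(y \<ominus> f) \<oplus> f \<in> P" using additive_subgroup.a_closed[OF P(1)] f(3) by blast
      moreover have "(y \<ominus> f) \<oplus> f = y" using c f by algebra
      ultimately show "y \<in> P" by simp
    qed
  next
    have WWW: "u \<otimes> v \<otimes> w = \<zero>" if "u \<in> W" "v \<in> W" "w \<in> W" for u v w
      using kill(1)[of "u \<otimes> v" w] J_prod(1)[of u v] that by (simp add: W_def)
    fix u v w
    assume mem: "u \<in> insert x (J 2) \<union> W" "v \<in> insert x (J 2) \<union> W" "w \<in> insert x (J 2) \<union> W"
    have c: "u \<in> carrier R" "v \<in> carrier R" "w \<in> carrier R"
      using mem car J_carrier by (auto simp: W_def)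
    have com: "s \<otimes> t = t \<otimes> s" if "s \<in> insert x (J 2)" "t \<in> insert x (J 2)" for s t
      using that comm by auto
    consider "u \<in> W" "v \<in> W" "w \<in> W"
      | "u \<in> insert x (J 2)" "v \<in> insert x (J 2)" "w \<in> insert x (J 2)"
      | "u \<in> W" "v \<in> insert x (J 2)" | "v \<in> W" "u \<in> insert x (J 2)"
      | "v \<in> W" "w \<in> insert x (J 2)" | "w \<in> W" "v \<in> insert x (J 2)"
      using mem by blast
    then show "u \<otimes> v \<otimes> w = w \<otimes> v \<otimes> u"
    proof cases
      case 1
      then show ?thesis using WWW by simp
    next
      case 2
      then show ?thesis using com c by (metis m_assoc)
    qed (use c kill in \<open>simp_all add: m_assoc\<close>)
  qed (use abc in auto)
qed

end

section \<open>Vanishing fourth power at the prime two\<close>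

context ring
begin

lemma incongruent5:
  assumes "additive_subgroup K R"
    "x1 \<in> carrier R" "x2 \<in> carrier R" "x3 \<in> carrier R" "x4 \<in> carrier R" "x5 \<in> carrier R"
    "x1 \<ominus> x2 \<notin> K" "x1 \<ominus> x3 \<notin> K" "x1 \<ominus> x4 \<notin> K" "x1 \<ominus> x5 \<notin> K" "x2 \<ominus> x3 \<notin> K"
    "x2 \<ominus> x4 \<notin> K" "x2 \<ominus> x5 \<notin> K" "x3 \<ominus> x4 \<notin> K" "x3 \<ominus> x5 \<notin> K" "x4 \<ominus> x5 \<notin> K"
  shows "card {x1, x2, x3, x4, x5} = 5"
    "\<And>d d'. \<lbrakk>d \<in> {x1, x2, x3, x4, x5}; d' \<in> {x1, x2, x3, x4, x5}; d \<ominus> d' \<in> K\<rbrakk> \<Longrightarrow> d = d'"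
proof -
  have refl: "x \<ominus> x \<in> K" if "x \<in> carrier R" for x
    using that additive_subgroup.zero_closed[OF assms(1)] by (simp add: a_minus_def r_neg)
  have sym: "y \<ominus> x \<in> K" if "x \<in> carrier R" "y \<in> carrier R" "x \<ominus> y \<in> K" for x y
  proof -
    have "y \<ominus> x = \<ominus> (x \<ominus> y)" using that by algebra
    then show ?thesis using additive_subgroup.a_inv_closed[OF assms(1)] that by simp
  qed
  have "x1 \<noteq> x2" "x1 \<noteq> x3" "x1 \<noteq> x4" "x1 \<noteq> x5" "x2 \<noteq> x3"
    "x2 \<noteq> x4" "x2 \<noteq> x5" "x3 \<noteq> x4" "x3 \<noteq> x5" "x4 \<noteq> x5"
    using assms refl by metis+
  then show "card {x1, x2, x3, x4, x5} = 5" by simp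
  fix d d' assume "d \<in> {x1, x2, x3, x4, x5}" "d' \<in> {x1, x2, x3, x4, x5}" "d \<ominus> d' \<in> K"
  then show "d = d'" 
    using assms sym[of d d'] by (elim insertE emptyE) simp_all
qed

lemma diff_mem_of_index_le_2:
  assumes "additive_subgroup A R" "finite A" "additive_subgroup B R" "B \<subseteq> A"
    "card A \<le> 2 * card B" "x \<in> A" "x \<notin> B" "y \<in> A" "y \<notin> B"
  shows "x \<ominus> y \<in> B"
proof (rule ccontr)
  assume xy: "x \<ominus> y \<notin> B"
  have car: "x \<in> carrier R" "y \<in> carrier R"
    using assms additive_subgroup.a_subset by blast+
  have neg: "\<ominus> z \<notin> B" if "z \<in> carrier R" "z \<notin> B" for z
    using additive_subgroup.a_inv_closed[OF assms(3), of "\<ominus> z"] that by auto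
  have yx: "y \<ominus> x \<notin> B" using neg[of "x \<ominus> y"] xy car by (simp add: a_minus_def minus_add a_comm)
  have xx: "z \<ominus> z = \<zero>" "z \<ominus> \<zero> = z" "\<zero> \<ominus> z = \<ominus> z" if "z \<in> carrier R" for z
    using that by (simp_all add: a_minus_def r_neg)
  have "card {\<zero>, x, y} * card B \<le> card A"
  proof (rule card_ge_incongruent[OF assms(1-4)])
    show "{\<zero>, x, y} \<subseteq> A" using assms additive_subgroup.zero_closed by auto
    fix d d' assume "d \<in> {\<zero>, x, y}" "d' \<in> {\<zero>, x, y}" "d \<ominus> d' \<in> B"
    then show "d = d'" using xy yx xx car neg assms(7,9) by (elim insertE emptyE) simp_all
  qed
  moreover have "card {\<zero>, x, y} = 3"
  proof -
    have "x \<noteq> \<zero>" "y \<noteq> \<zero>" "x \<noteq> y"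
      using assms(7,9) xy xx(1) car additive_subgroup.zero_closed[OF assms(3)] by metis+
    then show ?thesis by simp
  qed
  moreover have "0 < card B"
    using assms(2-4) additive_subgroup.zero_closed[OF assms(3)] by (metis card_gt_0_iff empty_iff finite_subset)
  ultimately show False using assms(5) by simp
qed

end

context nilpotent_filtration
begin

lemma double_mem:
  assumes "p = 2" "0 < k" "x \<in> J k"
  shows "x \<oplus> x \<in> J (Suc k)"
proof -
  have x: "x \<in> carrier R" using assms J_carrier by blast
  have "[(1 + 1 :: int)] \<cdot> x = x \<oplus> x" using x by (simp only: add.int_pow_mult add.int_pow_1)
  then show ?thesis using p_multiple[OF assms(2,3)] assms(1) by simp
qed

lemma eq_mult_of_congruent:
  assumes "J 4 = {\<zero>}" "s \<in> J 2" "t \<in> J 2" "s \<ominus> t \<in> J 3" "y \<in> J 1"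
  shows "s \<otimes> y = t \<otimes> y"
proof -
  have car: "s \<in> carrier R" "t \<in> carrier R" "y \<in> carrier R" using assms J_carrier by blast+
  have "(s \<ominus> t) \<otimes> y = \<zero>" using J_prod(6)[OF assms(4,5)] assms(1) by blast
  then have "s \<otimes> y \<ominus> t \<otimes> y = \<zero>" using car by (simp add: a_minus_def l_distr l_minus)
  then show ?thesis using car by (simp add: r_right_minus_eq)
qed

text \<open>
  The radical of the triple product: replacing a factor by one that is congruent modulo this
  subgroup does not change the product. It contains \<open>J 2\<close> when \<open>J 4\<close> vanishes.
\<close>
definition J2_ann where "J2_ann = {w \<in> J 1. \<forall>z\<in>J 2. z \<otimes> w = \<zero>}"

lemma J2_ann_subgroup: "additive_subgroup J2_ann R"
  using J_carrier additive_subgroup.zero_closed[OF J_subgroup]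
  by (intro additive_subgroupI add.subgroupI)
    (auto simp: J2_ann_def r_distr r_minus intro!: J_add J_minus J_zero)

lemma J2_ann_triple_zero:
  assumes "w \<in> J2_ann" "u \<in> J 1" "v \<in> J 1"
  shows "u \<otimes> v \<otimes> w = \<zero>" "v \<otimes> w \<otimes> u = \<zero>" "w \<otimes> u \<otimes> v = \<zero>"
proof -
  have car: "u \<in> carrier R" "v \<in> carrier R" "w \<in> carrier R" using assms J_carrier by (auto simp: J2_ann_def)
  show *: "u \<otimes> v \<otimes> w = \<zero>" using assms J_prod(1) by (auto simp: J2_ann_def)
  show "v \<otimes> w \<otimes> u = \<zero>" "w \<otimes> u \<otimes> v = \<zero>" using zero_rotate[OF car *] .
qed

lemma J2_ann_congruent:
  assumes "x \<in> J 1" "y \<in> J 1" "u \<in> J 1" "v \<in> J 1" "x \<ominus> y \<in> J2_ann"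
  shows "u \<otimes> v \<otimes> x = u \<otimes> v \<otimes> y" "u \<otimes> x \<otimes> v = u \<otimes> y \<otimes> v" "x \<otimes> u \<otimes> v = y \<otimes> u \<otimes> v"
proof -
  have car: "x \<in> carrier R" "y \<in> carrier R" "u \<in> carrier R" "v \<in> carrier R" 
    using assms J_carrier by blast+
  have "u \<otimes> v \<otimes> x \<ominus> u \<otimes> v \<otimes> y = u \<otimes> v \<otimes> (x \<ominus> y)" using car by algebra
  then show "u \<otimes> v \<otimes> x = u \<otimes> v \<otimes> y" using J2_ann_triple_zero[OF assms(5)] assms(1-4) car by (simp add: r_right_minus_eq)
  have "u \<otimes> x \<otimes> v \<ominus> u \<otimes> y \<otimes> v = u \<otimes> (x \<ominus> y) \<otimes> v" using car by algebra
  then show "u \<otimes> x \<otimes> v = u \<otimes> y \<otimes> v" using J2_ann_triple_zero[OF assms(5)] assms(1-4) car by (simp add: r_right_minus_eq)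
  have "x \<otimes> u \<otimes> v \<ominus> y \<otimes> u \<otimes> v = (x \<ominus> y) \<otimes> u \<otimes> v" using car by algebra
  then show "x \<otimes> u \<otimes> v = y \<otimes> u \<otimes> v" using J2_ann_triple_zero[OF assms(5)] assms(1-4) car by (simp add: r_right_minus_eq)
qed

text \<open>
  A vanishing \<open>v w u\<close> with \<open>u\<close> congruent to \<open>v + w\<close> says that \<open>v w v\<close> and \<open>v w w\<close> are opposite.
  Vanishing is invariant under rotation, so if one of the repeated products in \<open>v\<close> and \<open>w\<close>
  vanishes then they all do, and with them \<open>w v u\<close>.
\<close>
lemma dependent_triple_nonzero:
  assumes "u \<in> J 1" "v \<in> J 1" "w \<in> J 1" "u \<ominus> (v \<oplus> w) \<in> J2_ann"
    "v \<otimes> w \<otimes> u = \<zero>" "w \<otimes> v \<otimes> u \<noteq> \<zero>"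
  shows "v \<otimes> w \<otimes> v \<noteq> \<zero>" "v \<otimes> w \<otimes> w \<noteq> \<zero>" "w \<otimes> v \<otimes> v \<noteq> \<zero>" "w \<otimes> v \<otimes> w \<noteq> \<zero>"
    "w \<otimes> v \<otimes> u = w \<otimes> v \<otimes> v \<oplus> w \<otimes> v \<otimes> w"
proof -
  have car: "u \<in> carrier R" "v \<in> carrier R" "w \<in> carrier R"  using assms J_carrier by blast+
  have vw: "v \<oplus> w \<in> J 1" using assms J_add by blast
  have sum0: "v \<otimes> w \<otimes> v \<oplus> v \<otimes> w \<otimes> w = \<zero>"
    using J2_ann_congruent(1)[OF assms(1) vw assms(2,3,4)] assms(5) car by (simp add: r_distr)
  show sum1: "w \<otimes> v \<otimes> u = w \<otimes> v \<otimes> v \<oplus> w \<otimes> v \<otimes> w"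
    using J2_ann_congruent(1)[OF assms(1) vw assms(3,2,4)] car by (simp add: r_distr)
  have eq: "v \<otimes> w \<otimes> v = \<zero> \<longleftrightarrow> v \<otimes> w \<otimes> w = \<zero>" using sum0 car by auto
  have r1: "v \<otimes> w \<otimes> v = \<zero> \<longleftrightarrow> w \<otimes> v \<otimes> v = \<zero>"
    using zero_rotate(1)[of v w v] zero_rotate(2)[of w v v] car by blast
  have r2: "v \<otimes> w \<otimes> w = \<zero> \<longleftrightarrow> w \<otimes> v \<otimes> w = \<zero>"
    using zero_rotate(2)[of v w w] zero_rotate(1)[of w v w] car by blast
  have "\<not> v \<otimes> w \<otimes> v = \<zero>" using sum1 assms(6) eq r1 r2 car by auto
  then show "v \<otimes> w \<otimes> v \<noteq> \<zero>" "v \<otimes> w \<otimes> w \<noteq> \<zero>" "w \<otimes> v \<otimes> v \<noteq> \<zero>" "w \<otimes> v \<otimes> w \<noteq> \<zero>"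
    using eq r1 r2 by blast+
qed

lemma J2_subset_ann: "J 4 = {\<zero>} \<Longrightarrow> J 2 \<subseteq> J2_ann"
  using J_antimono[of 1 2] J_prod(5) by (auto simp: J2_ann_def)

text \<open>
  If \<open>J 2\<close> is generated over \<open>J 3\<close> by \<open>z1\<close> and \<open>z2\<close>, then an element of \<open>J 1\<close> modulo the radical is
  determined by its two products with \<open>z1\<close> and \<open>z2\<close>. These lie in \<open>J 3\<close>, a set of two elements.
\<close>
lemma J2_ann_incongruent_card_le_4:
  assumes "p = 2" "J 4 = {\<zero>}" "card (J 2) = 4 * card (J 3)" "card (J 3) = 2"
    "D \<subseteq> J 1" "\<And>d d'. \<lbrakk>d \<in> D; d' \<in> D; d \<ominus> d' \<in> J2_ann\<rbrakk> \<Longrightarrow> d = d'"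
  shows "card D \<le> 4"
proof -
  have p: "prime (2::nat)" "[(int 2)] \<cdot> x \<in> J 3" if "x \<in> J 2" for x
    using p_multiple[of 2 x] that assms(1) prime_p by simp_all
  have J32: "J 3 \<subseteq> J 2" using J_antimono[of 2 3] by simp
  have "J 2 \<noteq> J 3" using assms by auto
  then obtain z1 where z1: "z1 \<in> J 2" "z1 \<notin> J 3" using J32 by blast
  define B where "B = adjoin z1 (J 3)"
  have B: "additive_subgroup B R" "B \<subseteq> J 2" "J 3 \<subseteq> B"
    using adjoin_subgroup[OF J_subgroup] adjoin_superset[OF J_subgroup] adjoin_subset[OF J_subgroup J32]
      J_carrier[OF z1(1)] z1 by (simp_all add: B_def)
  have cardB: "card B = 2 * card (J 3)"
    unfolding B_def using card_adjoin[OF J_subgroup J_finite J_carrier[OF z1(1)] z1(2)] p[OF z1(1)] by simp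
  then have "J 2 \<noteq> B" using assms by auto
  then obtain z2 where z2: "z2 \<in> J 2" "z2 \<notin> B" using B by blast
  have J2: "J 2 = adjoin z2 B"
    using B z2 cardB assms(3) p[OF z2(1)] by (intro adjoin_eqI[of 2] J_subgroup J_finite) auto
  have car: "z1 \<in> carrier R" "z2 \<in> carrier R" using z1 z2 J_carrier by blast+
  have "inj_on (\<lambda>w. (z1 \<otimes> w, z2 \<otimes> w)) D"
  proof (rule inj_onI, clarify)
    fix w w' assume w: "w \<in> D" "w' \<in> D" "z1 \<otimes> w = z1 \<otimes> w'" "z2 \<otimes> w = z2 \<otimes> w'"
    define d where "d = w \<ominus> w'"
    have c: "w \<in> carrier R" "w' \<in> carrier R" using w assms(5) J_carrier by blast+
    have d: "d \<in> J 1" using w assms(5) unfolding d_def by (intro J_diff) auto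
    then have dc: "d \<in> carrier R" by (rule J_carrier)
    have z: "z1 \<otimes> d = \<zero>" "z2 \<otimes> d = \<zero>"
      using w car c by (simp_all add: d_def a_minus_def r_distr r_minus r_neg)
    have "z \<otimes> d = \<zero>" if zJ: "z \<in> J 2" for z
    proof -
      obtain k b where b: "b \<in> B" "z = [(k::int)] \<cdot> z2 \<oplus> b"
        using zJ unfolding J2 by (auto simp: adjoin_def)
      obtain l t where "t \<in> J 3" "b = [(l::int)] \<cdot> z1 \<oplus> t"
        using b(1) unfolding B_def by (auto simp: adjoin_def)
      with b have t: "t \<in> J 3" "z = [k] \<cdot> z2 \<oplus> ([l] \<cdot> z1 \<oplus> t)" by simp_all
      have "t \<otimes> d = \<zero>" using J_prod(6)[OF t(1) d] assms(2) by blast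
      then show ?thesis
        using t car dc z J_carrier[OF t(1)] by (simp add: l_distr add_pow_ldistr_int)
    qed
    then have "w \<ominus> w' \<in> J2_ann" using d by (simp add: J2_ann_def d_def)
    then show "w = w'" using assms(6) w by blast
  qed
  moreover have "(\<lambda>w. (z1 \<otimes> w, z2 \<otimes> w)) ` D \<subseteq> J 3 \<times> J 3"
    using z1 z2 assms(5) J_prod(3) by auto
  ultimately have "card D \<le> card (J 3 \<times> J 3)"
    using J_finite by (intro card_inj_on_le) auto
  then show ?thesis using assms(4) by (simp add: card_cartesian_product)
qed

text \<open>
  In a nonsymmetric triple the elements \<open>0, a, b, c\<close> are pairwise incongruent modulo the radical.
  Either \<open>a + b\<close> is a fifth class, which makes \<open>J 1\<close> large and rules out the small second and
  third quotients of \<open>J2_ann_incongruent_card_le_4\<close>, or \<open>c\<close> is congruent to \<open>a + b\<close>. In the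
  second case the relation is symmetric under rotation of \<open>a, b, c\<close>. Right multiplication then
  separates products of two factors: \<open>ab\<close>, \<open>bc\<close>, \<open>ca\<close> annihilate only \<open>c\<close>, \<open>a\<close>, \<open>b\<close>
  respectively among \<open>a, b, c\<close>, while \<open>ba\<close> annihilates none of them. This gives five classes of
  \<open>J 2\<close> modulo \<open>J 3\<close>; and \<open>cbb\<close>, \<open>cbc\<close> are distinct and nonzero in \<open>J 3\<close> because
  their sum is \<open>cba\<close>.
\<close>
theorem fourth_power_zero_bounds:
  assumes "p = 2" "J 4 = {\<zero>}" "a \<in> J 1" "b \<in> J 1" "c \<in> J 1"
    "a \<otimes> b \<otimes> c = \<zero>" "c \<otimes> b \<otimes> a \<noteq> \<zero>"
  shows "5 * card (J 3) \<le> card (J 2) \<and> 3 \<le> card (J 3) \<or>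
    5 * card (J 2) \<le> card (J 1) \<and> \<not> (card (J 2) = 4 * card (J 3) \<and> card (J 3) = 2)"
proof -
  have car: "a \<in> carrier R" "b \<in> carrier R" "c \<in> carrier R" using assms J_carrier by blast+
  have abc: "b \<otimes> c \<otimes> a = \<zero>" "c \<otimes> a \<otimes> b = \<zero>" using zero_rotate[OF car assms(6)] .
  have cba: "b \<otimes> a \<otimes> c \<noteq> \<zero>" "a \<otimes> c \<otimes> b \<noteq> \<zero>"
    using zero_rotate(1)[of a c b] zero_rotate(2)[of b a c] assms(7) car by blast+
  have dbl: "x \<oplus> x \<in> J2_ann" if "x \<in> J 1" for x
    using double_mem[OF assms(1) _ that] J2_subset_ann[OF assms(2)] by (auto simp: numeral_2_eq_2)
  note Kc = additive_subgroup.a_closed[OF J2_ann_subgroup] additive_subgroup.a_inv_closed[OF J2_ann_subgroup]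
    additive_subgroup_diff[OF J2_ann_subgroup]
  show ?thesis
  proof (cases "c \<ominus> (a \<oplus> b) \<in> J2_ann")
    case False
    have notK: "a \<notin> J2_ann" "b \<notin> J2_ann" "c \<notin> J2_ann"
      using J2_ann_triple_zero assms(3-5,7) by blast+
    have 1: "a \<ominus> b \<notin> J2_ann"
    proof
      assume *: "a \<ominus> b \<in> J2_ann"
      have "b \<otimes> b \<otimes> c = \<zero>" using J2_ann_congruent(3)[OF _ _ _ _ *] assms by metis
      then have "c \<otimes> b \<otimes> b = \<zero>" using zero_rotate car by blast
      then show False using J2_ann_congruent(1)[OF _ _ _ _ *] assms by metis
    qed
    have 2: "a \<ominus> c \<notin> J2_ann"
    proof
      assume *: "a \<ominus> c \<in> J2_ann"
      show False using J2_ann_congruent(1,3)[OF _ _ _ _ *] assms by metis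
    qed
    have 3: "b \<ominus> c \<notin> J2_ann"
    proof
      assume *: "b \<ominus> c \<in> J2_ann"
      have "a \<otimes> b \<otimes> b = \<zero>" using J2_ann_congruent(1)[OF _ _ _ _ *] assms by metis
      then have "b \<otimes> b \<otimes> a = \<zero>" using zero_rotate car by blast
      then show False using J2_ann_congruent(3)[OF _ _ _ _ *] assms by metis
    qed
    have 4: "a \<oplus> b \<notin> J2_ann"
    proof
      assume "a \<oplus> b \<in> J2_ann"
      moreover have "a \<ominus> b = (a \<oplus> b) \<ominus> (b \<oplus> b)" using car by algebra
      ultimately show False using 1 Kc(3) dbl assms by metis
    qed
    have 5: "a \<ominus> (a \<oplus> b) \<notin> J2_ann" "b \<ominus> (a \<oplus> b) \<notin> J2_ann"
    proof -
      have "a \<ominus> (a \<oplus> b) = \<ominus> b" "b \<ominus> (a \<oplus> b) = \<ominus> a" using car by algebra+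
      then show "a \<ominus> (a \<oplus> b) \<notin> J2_ann" "b \<ominus> (a \<oplus> b) \<notin> J2_ann"
        using notK Kc(2) car by (metis minus_minus)+
    qed
    have 6: "x \<ominus> \<zero> = x" if "x \<in> carrier R" for x using that by (simp add: a_minus_def)
    let ?D = "{a, b, c, a \<oplus> b, \<zero>}"
    have 7: "a \<ominus> \<zero> \<notin> J2_ann" "b \<ominus> \<zero> \<notin> J2_ann" "c \<ominus> \<zero> \<notin> J2_ann" "a \<oplus> b \<ominus> \<zero> \<notin> J2_ann"
      using 4 6 notK car by simp_all
    note D = incongruent5[OF J2_ann_subgroup car add.m_closed[OF car(1,2)] zero_closed
        1 2 5(1) 7(1) 3 5(2) 7(2) False 7(3,4)]
    have DJ: "?D \<subseteq> J 1" using assms J_add J_zero by blast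
    have "J2_ann \<subseteq> J 1" by (auto simp: J2_ann_def)
    then have "card ?D * card J2_ann \<le> card (J 1)"
      using D(2) DJ by (intro card_ge_incongruent J_subgroup J_finite J2_ann_subgroup)
    moreover have "card (J 2) \<le> card J2_ann"
      using J2_subset_ann[OF assms(2)] \<open>J2_ann \<subseteq> J 1\<close> J_finite by (meson card_mono finite_subset)
    ultimately have "5 * card (J 2) \<le> card (J 1)" using D(1) by simp
    moreover have "\<not> (card (J 2) = 4 * card (J 3) \<and> card (J 3) = 2)"
      using J2_ann_incongruent_card_le_4[OF assms(1,2) _ _ DJ D(2)] D(1) by fastforce
    ultimately show ?thesis by blast
  next
    case True
    have "a \<ominus> (b \<oplus> c) = \<ominus> (c \<ominus> (a \<oplus> b)) \<ominus> (b \<oplus> b)" "b \<ominus> (c \<oplus> a) = \<ominus> (c \<ominus> (a \<oplus> b)) \<ominus> (a \<oplus> a)"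
      using car by algebra+
    then have abK: "a \<ominus> (b \<oplus> c) \<in> J2_ann" "b \<ominus> (c \<oplus> a) \<in> J2_ann"
      using True Kc dbl assms by metis+
    note C = dependent_triple_nonzero[OF assms(5,3,4) True assms(6) cba(1)]
    note A = dependent_triple_nonzero[OF assms(3,4,5) abK(1) abc(1) assms(7)]
    note B = dependent_triple_nonzero[OF assms(4,5,3) abK(2) abc(2) cba(2)]
    have cbb: "c \<otimes> b \<otimes> b \<in> J 3" "c \<otimes> b \<otimes> c \<in> J 3" using assms J_prod(1,3) by blast+
    have "c \<otimes> b \<otimes> b \<noteq> c \<otimes> b \<otimes> c"
    proof
      assume "c \<otimes> b \<otimes> b = c \<otimes> b \<otimes> c"
      then have "c \<otimes> b \<otimes> a \<in> J 4" 
        using A(5) double_mem[OF assms(1) _ cbb(1)] by simp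
      then show False using assms by blast
    qed
    then have "card {\<zero>, c \<otimes> b \<otimes> b, c \<otimes> b \<otimes> c} = 3" using A by simp
    moreover have "{\<zero>, c \<otimes> b \<otimes> b, c \<otimes> b \<otimes> c} \<subseteq> J 3" using cbb J_zero by blast
    ultimately have "3 \<le> card (J 3)" using J_finite by (metis card_mono)
    have sq: "a \<otimes> b \<in> J 2" "b \<otimes> c \<in> J 2" "c \<otimes> a \<in> J 2" "b \<otimes> a \<in> J 2"
      using assms J_prod(1) by blast+
    have zm: "\<zero> \<otimes> y = \<zero>" if "y \<in> J 1" for y using J_carrier[OF that] by simp
    note eq = eq_mult_of_congruent[OF assms(2)]
    let ?E = "{a \<otimes> b, b \<otimes> c, c \<otimes> a, b \<otimes> a, \<zero>}"
    \<comment> \<open>in each case right multiplication by one of the three elements tells the two classes apart\<close>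
    have d1: "a \<otimes> b \<ominus> b \<otimes> c \<notin> J 3"
      using eq[OF sq(1,2) _ assms(3)] C(1) abc(1) by metis
    have d2: "a \<otimes> b \<ominus> c \<otimes> a \<notin> J 3"
      using eq[OF sq(1,3) _ assms(4)] C(2) abc(2) by metis
    have d3: "a \<otimes> b \<ominus> b \<otimes> a \<notin> J 3"
      using eq[OF sq(1,4) _ assms(5)] assms(6) cba(1) by metis
    have d4: "a \<otimes> b \<ominus> \<zero> \<notin> J 3"
      using eq[OF sq(1) J_zero _ assms(3)] C(1) zm[OF assms(3)] by metis
    have d5: "b \<otimes> c \<ominus> c \<otimes> a \<notin> J 3"
      using eq[OF sq(2,3) _ assms(4)] A(1) abc(2) by metis
    have d6: "b \<otimes> c \<ominus> b \<otimes> a \<notin> J 3"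
      using eq[OF sq(2,4) _ assms(3)] C(3) abc(1) by metis
    have d7: "b \<otimes> c \<ominus> \<zero> \<notin> J 3"
      using eq[OF sq(2) J_zero _ assms(4)] A(1) zm[OF assms(4)] by metis
    have d8: "c \<otimes> a \<ominus> b \<otimes> a \<notin> J 3"
      using eq[OF sq(3,4) _ assms(4)] C(4) abc(2) by metis
    have d9: "c \<otimes> a \<ominus> \<zero> \<notin> J 3"
      using eq[OF sq(3) J_zero _ assms(3)] B(2) zm[OF assms(3)] by metis
    have d10: "b \<otimes> a \<ominus> \<zero> \<notin> J 3"
      using eq[OF sq(4) J_zero _ assms(5)] cba(1) zm[OF assms(5)] by metis
    note E = incongruent5[OF J_subgroup sq(1-4)[THEN J_carrier] zero_closed d1 d2 d3 d4 d5 d6 d7 d8 d9 d10]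
    have "?E \<subseteq> J 2" using sq J_zero by blast
    moreover have "J 3 \<subseteq> J 2" using J_antimono[of 2 3] by simp
    ultimately have "card ?E * card (J 3) \<le> card (J 2)"
      using E(2) by (intro card_ge_incongruent J_subgroup J_finite)
    then show ?thesis using \<open>3 \<le> card (J 3)\<close> E(1) by simp
  qed
qed

end

section \<open>Quotients of dimensions 2, 2, 1, 1\<close>

context nilpotent_filtration
begin

text \<open>
  The case of quotients of dimensions 2, 2, 1, 1. As in the case of a one-dimensional second
  quotient, a nonzero product of four factors can be shifted until it is \<open>x\<^sup>4\<close>. Every element of
  \<open>J 1\<close> is then a sum of some of \<open>x\<close>, \<open>x\<^sup>2\<close> and an element of \<open>W\<close>, the annihilator of \<open>x\<^sup>2\<close>.
  Elements of \<open>W\<close> annihilate \<open>J 3\<close>, and modulo \<open>J 2\<close> there is at most one nonzero class of them.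
  A triple product with exactly one factor from \<open>W\<close> vanishes, and so does one with several such
  factors if some factor lies in \<open>J 2\<close>. Otherwise the factors from \<open>W\<close> may be taken equal, and then
  a product and its reversal are rotations of one another inside \<open>J 4\<close>, which has a single nonzero element.
\<close>
theorem order_2_2_1_1_reversal:
  assumes p2: "p = 2" and card: "card (J 1) \<le> 4 * card (J 2)" "card (J 3) = 2 * card (J 4)" "card (J 4) = 2"
    and J5: "J 5 = {\<zero>}" and abc: "a \<in> J 1" "b \<in> J 1" "c \<in> J 1"
  shows "a \<otimes> b \<otimes> c = c \<otimes> b \<otimes> a"
proof -
  have J4: "J 4 \<noteq> {\<zero>}" using card by auto
  have sub: "J 2 \<subseteq> J 1" "J 4 \<subseteq> J 3" "J 5 \<subseteq> J 4" "J 3 \<subseteq> J 2" "J 4 \<subseteq> J 1"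
    using J_antimono by auto
  have J3cong: "s \<ominus> t \<in> J 4" if "s \<in> J 3" "s \<notin> J 4" "t \<in> J 3" "t \<notin> J 4" for s t
    using diff_mem_of_index_le_2[OF J_subgroup J_finite J_subgroup sub(2) _ that] card(2) by simp
  have J4eq: "s = t" if "s \<in> J 4" "s \<noteq> \<zero>" "t \<in> J 4" "t \<noteq> \<zero>" for s t
    using diff_mem_of_index_le_2[OF J_subgroup J_finite J_subgroup sub(3) _ that(1) _ that(3)]
      card(3) J5 that J_carrier r_right_minus_eq by simp
  have J4_kill: "s \<otimes> t = \<zero>" "t \<otimes> s = \<zero>" if "s \<in> J 4" "t \<in> J 1" for s t
    using J_prod(7,8) that J5 by blast+
  have J23_kill: "s \<otimes> t = \<zero>" "t \<otimes> s = \<zero>" if "s \<in> J 2" "t \<in> J 3" for s t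
    using J_prod(9,10) that J5 by blast+
  have shift: "v \<otimes> w \<otimes> z \<otimes> z \<noteq> \<zero>"
    if mem: "u \<in> J 1" "v \<in> J 1" "w \<in> J 1" "z \<in> J 1" and nz: "u \<otimes> v \<otimes> w \<otimes> z \<noteq> \<zero>" for u v w z
  proof -
    have car: "u \<in> carrier R" "v \<in> carrier R" "w \<in> carrier R" "z \<in> carrier R"
      using mem J_carrier by blast+
    have J3: "u \<otimes> v \<otimes> w \<in> J 3" "v \<otimes> w \<otimes> z \<in> J 3" using mem J_prod(1,3) by blast+
    have "u \<otimes> v \<otimes> w \<notin> J 4" using nz J4_kill(1) mem(4) by blast
    moreover have "v \<otimes> w \<otimes> z \<notin> J 4" using nz J4_kill(2)[OF _ mem(1)] car by (auto simp: m_assoc)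
    ultimately have "u \<otimes> v \<otimes> w \<ominus> v \<otimes> w \<otimes> z \<in> J 4" using J3cong J3 by blast
    then have "(u \<otimes> v \<otimes> w \<ominus> v \<otimes> w \<otimes> z) \<otimes> z = \<zero>" using J4_kill(1) mem(4) by blast
    then have "u \<otimes> v \<otimes> w \<otimes> z \<ominus> v \<otimes> w \<otimes> z \<otimes> z = \<zero>" using car by (simp add: a_minus_def l_distr l_minus)
    then show ?thesis using nz car by (simp add: r_right_minus_eq)
  qed
  obtain u1 u2 u3 x where u: "u1 \<in> J 1" "u2 \<in> J 1" "u3 \<in> J 1" "x \<in> J 1" "u1 \<otimes> u2 \<otimes> u3 \<otimes> x \<noteq> \<zero>"
    using J_span4[OF J_subgroup[of 5]] J4 J5 J_zero[of 4] by blast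
  have x4: "x \<otimes> x \<otimes> x \<otimes> x \<noteq> \<zero>" using shift u by blast
  have x: "x \<in> carrier R" using u J_carrier by blast
  have x3J3: "x \<otimes> x \<otimes> x \<in> J 3" using J_prod(1,3) u by blast
  have x3: "x \<otimes> x \<otimes> x \<notin> J 4" using x4 J4_kill(1) u(4) by blast
  have x4J4: "x \<otimes> x \<otimes> x \<otimes> x \<in> J 4" using x3J3 J_prod(6) u(4) by blast
  have x2: "x \<notin> J 2" using J23_kill(2)[OF _ x3J3] x4 by blast
  define W where "W = {w \<in> J 1. x \<otimes> x \<otimes> w = \<zero>}"
  have W: "w \<in> J 1" "w \<in> carrier R" "x \<otimes> x \<otimes> w = \<zero>" "x \<otimes> x \<otimes> x \<otimes> w = \<zero>" if "w \<in> W" for w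
  proof -
    show w: "w \<in> J 1" "x \<otimes> x \<otimes> w = \<zero>" using that by (auto simp: W_def)
    show "w \<in> carrier R" using w J_carrier by blast
    with w x show "x \<otimes> x \<otimes> x \<otimes> w = \<zero>" by (simp add: m_assoc)
  qed
  have J3W: "t \<otimes> w = \<zero>" "w \<otimes> t = \<zero>" if t: "t \<in> J 3" and w: "w \<in> W" for t w
  proof -
    have tc: "t \<in> carrier R" using t J_carrier by blast
    show "t \<otimes> w = \<zero>"
    proof (cases "t \<in> J 4")
      case True
      then show ?thesis using J4_kill W(1)[OF w] by blast
    next
      case False
      then have "(t \<ominus> x \<otimes> x \<otimes> x) \<otimes> w = \<zero>"
        using J3cong[OF t _ x3J3 x3] J4_kill(1) W(1)[OF w] by blast
      then have "t \<otimes> w \<ominus> x \<otimes> x \<otimes> x \<otimes> w = \<zero>"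
        using tc x W(2)[OF w] by (simp add: a_minus_def l_distr l_minus)
      then show ?thesis using W(2,4)[OF w] tc x by (simp add: r_right_minus_eq)
    qed
    then show "w \<otimes> t = \<zero>" using reversible tc W(2)[OF w] by blast
  qed
  \<comment> \<open>a triple product with a factor in W and a further factor in J 2 vanishes\<close>
  have J2W: "u \<otimes> v \<otimes> w = \<zero>" "v \<otimes> w \<otimes> u = \<zero>" "w \<otimes> u \<otimes> v = \<zero>"
    if "w \<in> W" "u \<in> J 1" "v \<in> J 1" "u \<in> J 2 \<or> v \<in> J 2" for u v w
  proof -
    have c: "u \<in> carrier R" "v \<in> carrier R" "w \<in> carrier R" using that J_carrier W(2) by blast+
    have "u \<otimes> v \<in> J 3" using that J_prod(2,3) by blast
    then show *: "u \<otimes> v \<otimes> w = \<zero>" using J3W that by blast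
    show "v \<otimes> w \<otimes> u = \<zero>" "w \<otimes> u \<otimes> v = \<zero>" using zero_rotate[OF c *] .
  qed
  define U where "U = {y \<in> J 1. x \<otimes> x \<otimes> x \<otimes> y = \<zero>}"
  have U_sub: "additive_subgroup U R"
    using x J_carrier by (intro additive_subgroupI add.subgroupI)
      (auto simp: U_def r_distr r_minus intro!: J_add J_minus J_zero)
  have U1: "U \<subseteq> J 1" by (auto simp: U_def)
  have J2U: "J 2 \<subseteq> U" using sub(1) J23_kill(2)[OF _ x3J3] by (auto simp: U_def)
  have "card U \<le> 2 * card (J 2)"
  proof -
    have "x \<notin> U" using x4 by (simp add: U_def)
    then have notU: "x \<noteq> \<zero>" "x \<ominus> \<zero> \<notin> U" "\<zero> \<ominus> x \<notin> U"
      using x additive_subgroup.zero_closed[OF U_sub] additive_subgroup.a_inv_closed[OF U_sub, of "\<ominus> x"]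
      by (auto simp: a_minus_def)
    then have "card {\<zero>, x} * card U \<le> card (J 1)"
      using u(4) J_zero U1 by (intro card_ge_incongruent J_subgroup J_finite U_sub) auto
    then show ?thesis using card(1) notU(1) by simp
  qed
  then have Wcong: "w \<ominus> w' \<in> J 2" if "w \<in> W" "w \<notin> J 2" "w' \<in> W" "w' \<notin> J 2" for w w'
    using diff_mem_of_index_le_2[OF U_sub _ J_subgroup J2U] W that J_finite U1
    by (auto simp: U_def)
  have swap: "w' = w \<oplus> (w' \<ominus> w)" if "w \<in> carrier R" "w' \<in> carrier R" for w w' using that by algebra
  show ?thesis
  proof (rule triple_reversal_span[where X = "{x, x \<otimes> x} \<union> W" and A = "J 1"])
    show "{x, x \<otimes> x} \<union> W \<subseteq> carrier R" using x W(2) by auto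
  next
    fix P assume P: "additive_subgroup P R" "{x, x \<otimes> x} \<union> W \<subseteq> P"
    note Pa = additive_subgroup.a_closed[OF P(1)]
    have low: "y \<in> P" if y: "y \<in> J 1" "x \<otimes> x \<otimes> y \<in> J 4" for y
    proof (cases "x \<otimes> x \<otimes> y = \<zero>")
      case True
      then show ?thesis using P y by (auto simp: W_def)
    next
      case False
      have yc: "y \<in> carrier R" using y J_carrier by blast
      have xx: "x \<otimes> x \<in> J 1" using J_prod(1) u(4) sub(1) by blast
      have "x \<otimes> x \<otimes> y = x \<otimes> x \<otimes> (x \<otimes> x)" using J4eq[OF y(2) False x4J4 x4] x by (simp add: m_assoc)
      then have "x \<otimes> x \<otimes> (y \<ominus> x \<otimes> x) = \<zero>" using x yc by (simp add: a_minus_def r_distr r_minus r_neg)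
      then have "y \<ominus> x \<otimes> x \<in> P" using P(2) J_diff[OF y(1) xx] by (auto simp: W_def)
      then have "x \<otimes> x \<oplus> (y \<ominus> x \<otimes> x) \<in> P" using Pa P(2) by blast
      then show ?thesis using swap[of "x \<otimes> x" y] x yc by simp
    qed
    show "J 1 \<subseteq> P"
    proof
      fix y assume y: "y \<in> J 1"
      have yc: "y \<in> carrier R" using y J_carrier by blast
      show "y \<in> P"
      proof (cases "x \<otimes> x \<otimes> y \<in> J 4")
        case False
        have "x \<otimes> x \<otimes> y \<in> J 3" using J_prod(1,3) u(4) y by blast
        then have "x \<otimes> x \<otimes> y \<ominus> x \<otimes> x \<otimes> x \<in> J 4" using J3cong False x3J3 x3 by blast
        then have "x \<otimes> x \<otimes> (y \<ominus> x) \<in> J 4" using x yc by (simp add: a_minus_def r_distr r_minus)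
        then have "y \<ominus> x \<in> P" using low J_diff y u(4) by blast
        then have "x \<oplus> (y \<ominus> x) \<in> P" using Pa P(2) by blast
        then show ?thesis using swap[of x y] x yc by simp
      qed (use low y in blast)
    qed
  next
    have sq: "x \<otimes> x \<in> J 2" using J_prod(1) u(4) by blast
    have one: "s \<otimes> t \<otimes> w = \<zero>" "t \<otimes> w \<otimes> s = \<zero>" "w \<otimes> s \<otimes> t = \<zero>"
      if "w \<in> W" "s \<in> {x, x \<otimes> x}" "t \<in> {x, x \<otimes> x}" for s t w
    proof -
      have c: "s \<in> carrier R" "t \<in> carrier R" "w \<in> carrier R" using that x W(2) by auto
      show *: "s \<otimes> t \<otimes> w = \<zero>" 
        using that W(2,3,4)[OF that(1)] x by (auto simp: m_assoc)
      show "t \<otimes> w \<otimes> s = \<zero>" "w \<otimes> s \<otimes> t = \<zero>" using zero_rotate[OF c *] .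
    qed
    have mid: "w' \<otimes> s \<otimes> w = w \<otimes> s \<otimes> w'" if "w \<in> W" "w' \<in> W" "s \<in> {x, x \<otimes> x} \<union> W" for w w' s
    proof (cases "w \<in> J 2 \<or> w' \<in> J 2")
      case True
      have s: "s \<in> J 1" using that u(4) sq sub(1) W(1) by blast
      show ?thesis using True J2W[OF that(1) _ s] J2W[OF that(2) _ s] J2W(1,3)[OF that(1) W(1)[OF that(2)] s]
          J2W(1,3)[OF that(1) s W(1)[OF that(2)]] J2W(1,3)[OF that(2) W(1)[OF that(1)] s]
          J2W(1,3)[OF that(2) s W(1)[OF that(1)]]
        by auto
    next
      case False
      then have d: "w' \<ominus> w \<in> J 2" using Wcong that by blast
      define e where "e = w' \<ominus> w"
      have s: "s \<in> J 1" using that u(4) sq sub(1) W(1) by blast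
      have e: "e \<in> J 2" "e \<in> J 1" "e \<in> carrier R" "s \<in> carrier R" "w \<in> carrier R"
        using d sub(1) J_carrier s W(2) that by (auto simp: e_def)
      have w': "w' = w \<oplus> e" using swap W(2) that by (simp add: e_def)
      have "e \<otimes> s \<otimes> w = \<zero>" "w \<otimes> s \<otimes> e = \<zero>" using J2W that(1) e s by blast+
      then show ?thesis unfolding w' using e by (simp add: l_distr r_distr)
    qed
    have side: "s \<otimes> w \<otimes> w' = w' \<otimes> w \<otimes> s" if "w \<in> W" "w' \<in> W" "s \<in> {x, x \<otimes> x}" for w w' s
    proof (cases "w \<in> J 2 \<or> w' \<in> J 2 \<or> s = x \<otimes> x")
      case True
      have s: "s \<in> J 1" using that u(4) sq sub(1) W(1) by blast
      show ?thesis using True sq J2W(1,3)[OF that(1) W(1)[OF that(2)] s] J2W[OF that(1) s W(1)[OF that(2)]] 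
           J2W[OF that(2) W(1)[OF that(1)] s] J2W[OF that(2) s W(1)[OF that(1)]]
           J2W[OF that(1) W(1)[OF that(2)] s]
        by auto
    next
      case False
      then have sx: "s = x" using that by blast
      have d: "w' \<ominus> w \<in> J 2" using Wcong that False by blast
      define e where "e = w' \<ominus> w"
      have e: "e \<in> J 2" "e \<in> J 1" "e \<in> carrier R" "w \<in> carrier R"
        using d sub(1) J_carrier W(2) that by (auto simp: e_def)
      have w': "w' = w \<oplus> e" using swap W(2) that by (simp add: e_def)
      have "x \<otimes> w \<otimes> e = \<zero>" "e \<otimes> w \<otimes> x = \<zero>" using J2W that(1) e u(4) by blast+
      then have eq: "s \<otimes> w \<otimes> w' = x \<otimes> w \<otimes> w" "w' \<otimes> w \<otimes> s = w \<otimes> w \<otimes> x"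
        unfolding w' sx using e x by (simp_all add: l_distr r_distr)
      \<comment> \<open>both products lie in the minimal subgroup J 4, and they are rotations of each other\<close>
      have J4t: "t \<in> J 4" if "t \<in> J 3" "x \<otimes> t = \<zero>" for t
      proof (rule ccontr)
        assume "t \<notin> J 4"
        then have "x \<otimes> (t \<ominus> x \<otimes> x \<otimes> x) = \<zero>" using J3cong that(1) x3J3 x3 J4_kill u(4) by blast
        then show False using that x x4 J_carrier[OF that(1)]
          by (simp add: a_minus_def r_distr r_minus m_assoc)
      qed
      have ww: "x \<otimes> w \<otimes> w \<in> J 3" "w \<otimes> w \<otimes> x \<in> J 3" using J_prod(1,3) u(4) W(1) that by blast+
      have "x \<otimes> (x \<otimes> w \<otimes> w) = \<zero>" using W(3)[OF that(1)] x e by (simp flip: m_assoc)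
      moreover have "x \<otimes> (w \<otimes> w \<otimes> x) = \<zero>"
      proof -
        have "x \<otimes> x \<otimes> w \<otimes> w = \<zero>" using W(3)[OF that(1)] x e by simp
        then show ?thesis using zero_rotate(1)[of x "x \<otimes> w \<otimes> w" \<one>] zero_rotate(1)[of x "x \<otimes> w" w]
            zero_rotate(2)[of "x" "w \<otimes> w" "x"] x e by (simp add: m_assoc)
      qed
      ultimately have "x \<otimes> w \<otimes> w \<in> J 4" "w \<otimes> w \<otimes> x \<in> J 4" using J4t ww by blast+
      moreover have "x \<otimes> w \<otimes> w = \<zero> \<longleftrightarrow> w \<otimes> w \<otimes> x = \<zero>"
        using zero_rotate(1)[of x w w] zero_rotate(2)[of w w x] x e by blast
      ultimately show ?thesis using J4eq eq by metis
    qed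
    fix r s t
    assume mem: "r \<in> {x, x \<otimes> x} \<union> W" "s \<in> {x, x \<otimes> x} \<union> W" "t \<in> {x, x \<otimes> x} \<union> W"
    consider "r \<in> W" "t \<in> W" | "r \<in> {x, x \<otimes> x}" "s \<in> {x, x \<otimes> x}" "t \<in> W"
      | "r \<in> W" "s \<in> {x, x \<otimes> x}" "t \<in> {x, x \<otimes> x}" | "r \<in> {x, x \<otimes> x}" "s \<in> W" "t \<in> {x, x \<otimes> x}"
      | "r \<in> {x, x \<otimes> x}" "s \<in> W" "t \<in> W" | "r \<in> W" "s \<in> W" "t \<in> {x, x \<otimes> x}"
      | "r \<in> {x, x \<otimes> x}" "s \<in> {x, x \<otimes> x}" "t \<in> {x, x \<otimes> x}"
      using mem by blast
    then show "r \<otimes> s \<otimes> t = t \<otimes> s \<otimes> r"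
    proof cases
      case 7
      then show ?thesis using x by (auto simp: m_assoc)
    next
      case 1
      then show ?thesis using mid mem(2) by blast
    next
      case 5
      then show ?thesis using side by blast
    next
      case 6
      then show ?thesis using side by metis
    qed (use one in simp_all)
  qed (use abc in auto)
qed

end

section \<open>The order of a nonsymmetric reversible ring\<close>

context nilpotent_filtration
begin

text \<open>
  Let \<open>n1, n2, n3\<close> be the dimensions of the first three quotients. The two cyclic cases give
  \<open>n1 \<ge> 2\<close> and \<open>n2 \<ge> 2\<close>, and \<open>n3 \<ge> 1\<close> since \<open>cba\<close> is a nonzero element of \<open>J 3\<close>. For
  \<open>p \<ge> 3\<close> the resulting sixth power of \<open>p\<close> is already large enough. For \<open>p = 2\<close> two more dimensions are
  needed, and the few distributions of total dimension at most six are those excluded by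
  \<open>fourth_power_zero_bounds\<close> and \<open>order_2_2_1_1_reversal\<close>.
\<close>
theorem nonsymmetric_card_bound:
  assumes abc: "a \<in> J 1" "b \<in> J 1" "c \<in> J 1" and zero: "a \<otimes> b \<otimes> c = \<zero>" and nz: "c \<otimes> b \<otimes> a \<noteq> \<zero>"
  shows "256 \<le> p * card (J 1)"
proof -
  have car: "a \<in> carrier R" "b \<in> carrier R" "c \<in> carrier R" using abc J_carrier by blast+
  have cba: "c \<otimes> b \<otimes> a \<in> J 3" using J_prod(1,3) abc by blast
  have ne: "J k \<noteq> {\<zero>}" if "k \<le> 3" for k using J_antimono[OF that] cba nz by auto
  obtain n1 where n1: "0 < n1" "card (J 1) = p ^ n1 * card (J 2)"
    using J_index_pos[of 1] ne by (auto simp: numeral_2_eq_2)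
  obtain n2 where n2: "0 < n2" "card (J 2) = p ^ n2 * card (J 3)"
    using J_index_pos[of 2] ne by auto
  obtain n3 where n3: "0 < n3" "card (J 3) = p ^ n3 * card (J 4)"
    using J_index_pos[of 3] ne by auto
  have "n1 \<noteq> 1"
  proof
    assume "n1 = 1"
    then have comm: "x \<otimes> y = y \<otimes> x" if "x \<in> J 1" "y \<in> J 1" for x y
      using cyclic_top_commutative n1 that by simp
    have "b \<otimes> c \<in> J 1" using J_prod(1) abc J_antimono[of 1 2] by auto
    then have "c \<otimes> b \<otimes> a = a \<otimes> b \<otimes> c" using comm abc car by (metis m_assoc)
    then show False using zero nz by simp
  qed
  moreover have "n2 \<noteq> 1"
    using cyclic_square_reversal[OF _ ne abc] n2 zero nz by auto
  ultimately have n: "2 \<le> n1" "2 \<le> n2" "1 \<le> n3" using n1 n2 n3 by auto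
  have card: "card (J 1) = p ^ (n1 + n2 + n3) * card (J 4)"
    using n1 n2 n3 by (simp add: power_add)
  have p2: "2 \<le> p" using prime_p prime_ge_2_nat by blast
  show ?thesis
  proof (cases "p = 2")
    case False
    have "(256::nat) \<le> 3 ^ 6" by simp
    also have "\<dots> \<le> p ^ 6" using p2 False by (intro power_mono) auto
    also have "\<dots> \<le> p ^ Suc (n1 + n2 + n3)" using p2 n by (intro power_increasing) auto
    also have "\<dots> \<le> p * card (J 1)" using card J_card_pos[of 4] by simp
    finally show ?thesis .
  next
    case True
    show ?thesis
    proof (rule ccontr)
      assume "\<not> 256 \<le> p * card (J 1)"
      then have less: "2 ^ (n1 + n2 + n3) * card (J 4) < 2 ^ 7" using True card by simp
      have pow3: "3 \<le> k" if "5 \<le> (2::nat) ^ k" for k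
      proof (rule ccontr)
        assume "\<not> 3 \<le> k"
        then have "(2::nat) ^ k \<le> 2 ^ 2" by (intro power_increasing) auto
        with that show False by simp
      qed
      show False
      proof (cases "J 4 = {\<zero>}")
        case J4: True
        then have "card (J 4) = 1" by simp
        then have "(2::nat) ^ (n1 + n2 + n3) < 2 ^ 7" using less by (simp only: mult_1_right)
        then have sum: "n1 + n2 + n3 < 7" by (rule power_less_imp_less_exp[rotated]) simp
        have c3: "card (J 3) = 2 ^ n3" "card (J 2) = 2 ^ n2 * card (J 3)" "card (J 1) = 2 ^ n1 * card (J 2)"
          using n1 n2 n3 True J4 by simp_all
        from fourth_power_zero_bounds[OF True J4 abc zero nz] show False
        proof (elim disjE conjE)
          assume "5 * card (J 3) \<le> card (J 2)" "3 \<le> card (J 3)"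
          then have "3 \<le> n2" "n3 \<noteq> 1" using c3 J_card_pos[of 3] pow3 by auto
          then show False using sum n by linarith
        next
          assume "5 * card (J 2) \<le> card (J 1)" "\<not> (card (J 2) = 4 * card (J 3) \<and> card (J 3) = 2)"
          then have "3 \<le> n1" "\<not> (n2 = 2 \<and> n3 = 1)" using c3 J_card_pos[of 2] pow3 by auto
          then show False using sum n by linarith
        qed
      next
        case False
        obtain n4 where n4: "0 < n4" "card (J 4) = 2 ^ n4 * card (J 5)"
          using J_index_pos[of 4] False True by auto
        then have less': "2 ^ (n1 + n2 + n3 + n4) * card (J 5) < 2 ^ 7"
          using less by (simp add: power_add)
        moreover have "2 ^ (n1 + n2 + n3 + n4) * 1 \<le> 2 ^ (n1 + n2 + n3 + n4) * card (J 5)"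
          using J_card_pos[of 5] by (intro mult_left_mono) auto
        ultimately have "(2::nat) ^ (n1 + n2 + n3 + n4) < 2 ^ 7" by linarith
        then have "n1 + n2 + n3 + n4 < 7" by (rule power_less_imp_less_exp[rotated]) simp
        then have ns: "n1 = 2" "n2 = 2" "n3 = 1" "n4 = 1" using n n4 by linarith+
        then have "card (J 5) = 1" using less' J_card_pos[of 5] by simp
        then have J5: "J 5 = {\<zero>}" using J_zero[of 5] by (metis card_1_singletonE singletonD)
        show False
          using order_2_2_1_1_reversal[OF True _ _ _ J5 abc] n1 n2 n3 n4 ns True \<open>card (J 5) = 1\<close> zero nz
          by simp
      qed
    qed
  qed
qed

lemma idempotent_eq_zero:
  assumes "e \<in> J 1" "e \<otimes> e = e" "0 < m"
  shows "e = \<zero>"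
proof -
  have "e [^] Suc k = e" for k :: nat
    using J_carrier[OF assms(1)] assms(2) by (induction k) simp_all
  then have "e \<in> J m" using J_power[OF assms(1,3)] assms(3) by (metis Suc_pred)
  then show ?thesis using J_nilpotent by simp
qed

end

context ring
begin

definition additive_span :: "'a set \<Rightarrow> 'a set" where "additive_span = generate (add_monoid R)"

lemma span_subgroup: "S \<subseteq> carrier R \<Longrightarrow> additive_subgroup (additive_span S) R"
  unfolding additive_span_def by (intro additive_subgroupI add.generate_is_subgroup)

lemma span_superset: "S \<subseteq> additive_span S"
  unfolding additive_span_def by (auto intro: generate.incl)

lemma span_minimal: "\<lbrakk>S \<subseteq> P; additive_subgroup P R\<rbrakk> \<Longrightarrow> additive_span S \<subseteq> P"
  unfolding additive_span_def using add.generate_subgroup_incl additive_subgroup.a_subgroup by blast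

lemma span_mult_subset:
  assumes "additive_subgroup P R" "S \<subseteq> carrier R" "T \<subseteq> carrier R"
    "\<And>s t. \<lbrakk>s \<in> S; t \<in> T\<rbrakk> \<Longrightarrow> s \<otimes> t \<in> P" "u \<in> additive_span S" "v \<in> additive_span T"
  shows "u \<otimes> v \<in> P"
proof -
  have 1: "additive_span S \<subseteq> {x \<in> carrier R. x \<otimes> t \<in> P}" if "t \<in> T" for t
    using assms that by (intro span_minimal additive_subgroup_right_quotient) auto
  have "u \<in> carrier R"
    using assms(5) span_subgroup[OF assms(2)] additive_subgroup.a_subset by blast
  then have "additive_span T \<subseteq> {x \<in> carrier R. u \<otimes> x \<in> P}"
    using assms(1,3,5) 1 by (intro span_minimal additive_subgroup_left_quotient) blast+
  then show ?thesis using assms(6) by blast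
qed

definition word :: "'a list \<Rightarrow> 'a" where "word w = foldr (\<otimes>) w \<one>"

lemma word_simps [simp]: "word [] = \<one>" "word (x # w) = x \<otimes> word w"
  by (simp_all add: word_def)

lemma word_closed [simp]: "set w \<subseteq> carrier R \<Longrightarrow> word w \<in> carrier R"
  by (induction w) auto

lemma word_append:
  "\<lbrakk>set v \<subseteq> carrier R; set w \<subseteq> carrier R\<rbrakk> \<Longrightarrow> word (v @ w) = word v \<otimes> word w"
  by (induction v) (auto simp: m_assoc)

text \<open>
  Products of at least \<open>k\<close> factors from \<open>G\<close>; their additive spans are the powers of the nonunital
  subring generated by \<open>G\<close>.
\<close>
definition words :: "'a set \<Rightarrow> nat \<Rightarrow> 'a set" where
  "words G k = {word w |w. set w \<subseteq> G \<and> k \<le> length w}"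

lemma words_closed: "G \<subseteq> carrier R \<Longrightarrow> words G k \<subseteq> carrier R"
  by (auto simp: words_def intro!: word_closed)

lemma idempotent_power:
  assumes "finite (carrier R)" "g \<in> carrier R"
  shows "\<exists>n>0::nat. g [^] n \<otimes> g [^] n = g [^] n"
proof -
  have "\<not> inj (\<lambda>n::nat. g [^] n)"
    using finite_subset[OF _ assms(1), of "range (\<lambda>n::nat. g [^] n)"] assms(2) finite_imageD[of "\<lambda>n::nat. g [^] n" UNIV] by auto
  then obtain i j :: nat where "i < j" "g [^] i = g [^] j"
    by (metis injI linorder_neqE_nat)
  then obtain d where d: "0 < d" "g [^] (i + d) = g [^] i"
    by (metis less_imp_add_positive)
  have step: "g [^] (m + d) = g [^] m" if "i \<le> m" for m
  proof -
    define r where "r = m - i"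
    with that have m: "m = i + r" by simp
    have "g [^] (m + d) = g [^] (i + d) \<otimes> g [^] r"
      using nat_pow_mult[OF assms(2), of "i + d" r] by (simp add: m ac_simps)
    also have "\<dots> = g [^] m" using nat_pow_mult[OF assms(2), of i r] by (simp add: d m)
    finally show ?thesis .
  qed
  have steps: "g [^] (m + k * d) = g [^] m" if "i \<le> m" for m k
  proof (induction k)
    case (Suc k)
    then show ?case using step[of "m + k * d"] that by (simp add: ac_simps)
  qed simp
  let ?n = "Suc i * d"
  have "i * 1 \<le> Suc i * d" using d(1) by (intro mult_le_mono) auto
  then have "i \<le> ?n" by simp
  then have "g [^] ?n \<otimes> g [^] ?n = g [^] ?n"
    using steps[of ?n "Suc i"] nat_pow_mult[OF assms(2), of ?n ?n] by simp
  moreover have "0 < ?n" using d(1) by simp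
  ultimately show ?thesis by blast
qed

end

context reversible_ring
begin

text \<open>
  Insert \<open>x\<close> into \<open>e (1 - e) = 0\<close> and into \<open>(1 - e) e = 0\<close>.
\<close>
lemma idempotent_central:
  assumes "e \<in> carrier R" "e \<otimes> e = e" "x \<in> carrier R"
  shows "e \<otimes> x = x \<otimes> e"
proof -
  have f: "\<one> \<ominus> e \<in> carrier R" using assms by simp
  have "e \<otimes> (\<one> \<ominus> e) = \<zero>" "(\<one> \<ominus> e) \<otimes> e = \<zero>"
    using assms by (simp_all add: a_minus_def l_distr r_distr l_minus r_minus r_neg)
  then have "e \<otimes> x \<otimes> (\<one> \<ominus> e) = \<zero>" "(\<one> \<ominus> e) \<otimes> x \<otimes> e = \<zero>"
    using zero_insert[OF assms(1) f assms(3)] zero_insert[OF f assms(1,3)] by blast+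
  moreover have "e \<otimes> x \<otimes> (\<one> \<ominus> e) = e \<otimes> x \<ominus> e \<otimes> x \<otimes> e" "(\<one> \<ominus> e) \<otimes> x \<otimes> e = x \<otimes> e \<ominus> e \<otimes> x \<otimes> e"
    using assms(1,3) by (simp_all add: a_minus_def l_distr r_distr l_minus r_minus)
  ultimately have "e \<otimes> x \<ominus> e \<otimes> x \<otimes> e = \<zero>" "x \<otimes> e \<ominus> e \<otimes> x \<otimes> e = \<zero>" by simp_all
  then have "e \<otimes> x = e \<otimes> x \<otimes> e" "x \<otimes> e = e \<otimes> x \<otimes> e" using assms by (simp_all add: r_right_minus_eq)
  then show ?thesis by (rule trans[OF _ sym])
qed

lemma idempotent_mult_power:
  assumes "e \<in> carrier R" "e \<otimes> e = e" "x \<in> carrier R" "0 < (n::nat)"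
  shows "(e \<otimes> x) [^] n = e \<otimes> x [^] n"
proof -
  have "e [^] Suc k = e" for k :: nat
    using assms by (induction k) simp_all
  then have "e [^] n = e" using assms(4) by (metis Suc_pred)
  then show ?thesis
    using pow_mult_distrib[OF idempotent_central[OF assms(1-3)] assms(1,3), of n] by simp
qed

text \<open>
  Fitting decomposition: with \<open>e\<close> an idempotent power of \<open>g\<close>, the element \<open>g\<close> is nilpotent in
  the corner \<open>1 - e\<close>, and nothing of \<open>t\<close> is lost there if \<open>e t = 0\<close>.
\<close>
lemma nilpotent_corner:
  assumes "finite (carrier R)" "g \<in> carrier R" "t \<in> carrier R"
    "\<And>n. \<lbrakk>0 < (n::nat); g [^] n \<otimes> g [^] n = g [^] n\<rbrakk> \<Longrightarrow> g [^] n \<otimes> t = \<zero>"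
  shows "\<exists>f\<in>carrier R. f \<otimes> f = f \<and> f \<otimes> t = t \<and> (\<exists>n>0::nat. (f \<otimes> g) [^] n = \<zero>)"
proof -
  obtain n :: nat where n: "0 < n" "g [^] n \<otimes> g [^] n = g [^] n"
    using idempotent_power assms by blast
  let ?e = "g [^] n"
  let ?f = "\<one> \<ominus> ?e"
  have e: "?e \<in> carrier R" using assms by simp
  have f: "?f \<in> carrier R" "?f \<otimes> ?e = \<zero>" "?f \<otimes> ?f = ?f"
    using e n by (simp_all add: a_minus_def l_distr r_distr l_minus r_minus r_neg)
  have "?f \<otimes> t = t"
    using assms(3,4) n e by (simp add: a_minus_def l_distr l_minus)
  moreover have "(?f \<otimes> g) [^] n = \<zero>"
    using idempotent_mult_power f n assms by simp
  ultimately show ?thesis using f n by blast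
qed

lemma common_nilpotent_corner:
  assumes "finite (carrier R)" "finite G" "G \<subseteq> carrier R" "t \<in> carrier R"
    "\<And>g n. \<lbrakk>g \<in> G; 0 < (n::nat); g [^] n \<otimes> g [^] n = g [^] n\<rbrakk> \<Longrightarrow> g [^] n \<otimes> t = \<zero>"
  shows "\<exists>f\<in>carrier R. f \<otimes> f = f \<and> f \<otimes> t = t \<and> (\<forall>g\<in>G. \<exists>n>0::nat. (f \<otimes> g) [^] n = \<zero>)"
  using assms(2,3,5)
proof (induction G rule: finite_induct)
  case empty
  then show ?case using assms(4) by (intro bexI[of _ \<one>]) auto
next
  case (insert h G)
  then obtain e where e: "e \<in> carrier R" "e \<otimes> e = e" "e \<otimes> t = t"
    "\<And>g. g \<in> G \<Longrightarrow> \<exists>n>0::nat. (e \<otimes> g) [^] n = \<zero>"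
    by auto
  obtain f where f: "f \<in> carrier R" "f \<otimes> f = f" "f \<otimes> t = t" "\<exists>n>0::nat. (f \<otimes> h) [^] n = \<zero>"
    using nilpotent_corner[OF assms(1) _ assms(4), of h] insert.prems by auto
  have ef: "f \<otimes> e = e \<otimes> f" using idempotent_central f e by blast
  have nil: "\<exists>n>0::nat. (a \<otimes> (b \<otimes> g)) [^] n = \<zero>"
    if "a \<in> carrier R" "a \<otimes> a = a" "b \<in> carrier R" "g \<in> carrier R" "\<exists>n>0::nat. (b \<otimes> g) [^] n = \<zero>"
    for a b g
    using that idempotent_mult_power[of a "b \<otimes> g"] by (metis m_closed r_null)
  show ?case
  proof (intro bexI[of _ "f \<otimes> e"] conjI ballI)
    show "f \<otimes> e \<in> carrier R" using f e by simp
    have "f \<otimes> e \<otimes> (f \<otimes> e) = f \<otimes> (e \<otimes> f) \<otimes> e" using f(1) e(1) by (simp add: m_assoc)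
    also have "\<dots> = (f \<otimes> f) \<otimes> (e \<otimes> e)" unfolding ef[symmetric] using f(1) e(1) by (simp add: m_assoc)
    finally show "f \<otimes> e \<otimes> (f \<otimes> e) = f \<otimes> e" using f e by simp
    show "f \<otimes> e \<otimes> t = t" using f e assms(4) by (simp add: m_assoc)
    fix g assume g: "g \<in> insert h G"
    then have gc: "g \<in> carrier R" using insert.prems by blast
    show "\<exists>n>0::nat. (f \<otimes> e \<otimes> g) [^] n = \<zero>"
    proof (cases "g = h")
      case True
      then show ?thesis using nil[of e f g] ef e f gc by (simp add: m_assoc)
    next
      case False
      then show ?thesis using nil[of f e g] e f gc g by (simp add: m_assoc)
    qed
  qed
qed

text \<open>
  By insertion a product vanishes as soon as sufficiently many of its factors equal a nilpotent \<open>g\<close>,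
  whatever stands between them. The prefix \<open>x\<close> carries the factors already read.
\<close>
lemma word_zero:
  assumes "x \<in> carrier R" "g \<in> carrier R" "set w \<subseteq> carrier R" "x \<otimes> g [^] n = \<zero>" "n \<le> count_list w g"
  shows "x \<otimes> word w = \<zero>"
  using assms
proof (induction w arbitrary: x n)
  case Nil
  then show ?case by simp
next
  case (Cons h w)
  have h: "h \<in> carrier R" "set w \<subseteq> carrier R" using Cons.prems by auto
  show ?case
  proof (cases "n = 0")
    case True
    then show ?thesis using Cons.prems by simp
  next
    case False
    then obtain k where k: "n = Suc k" by (cases n) auto
    have xh: "x \<otimes> h \<otimes> word w = x \<otimes> word (h # w)" using h Cons.prems by (simp add: m_assoc)
    show ?thesis
    proof (cases "h = g")
      case True
      have "g [^] n = g \<otimes> g [^] k" unfolding k using Cons.prems(2) by (rule nat_pow_Suc2)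
      then have "x \<otimes> h \<otimes> g [^] k = \<zero>" using Cons.prems True by (simp add: m_assoc)
      then show ?thesis using Cons.IH[of "x \<otimes> h" k] Cons.prems h True k xh by simp
    next
      case False
      have "x \<otimes> h \<otimes> g [^] n = \<zero>" using zero_insert Cons.prems h by simp
      then show ?thesis using Cons.IH[of "x \<otimes> h" n] Cons.prems h False xh by simp
    qed
  qed
qed

lemma long_words_zero:
  assumes "finite G" "G \<subseteq> carrier R" "\<And>g. g \<in> G \<Longrightarrow> \<exists>n::nat. g [^] n = \<zero>"
  shows "\<exists>m>0. words G m \<subseteq> {\<zero>}"
proof -
  obtain n :: "'a \<Rightarrow> nat" where n: "\<And>g. g \<in> G \<Longrightarrow> g [^] n g = \<zero>"
    using assms(3) by metis
  let ?m = "Suc (\<Sum>g\<in>G. n g)"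
  have "word w = \<zero>" if w: "set w \<subseteq> G" "?m \<le> length w" for w
  proof -
    have "\<exists>g\<in>G. n g \<le> count_list w g"
    proof (rule ccontr)
      assume "\<not> ?thesis"
      then have "(\<Sum>g\<in>G. count_list w g) \<le> (\<Sum>g\<in>G. n g)" by (intro sum_mono) auto
      moreover have "(\<Sum>g\<in>G. count_list w g) = length w"
        using sum_count_set[OF w(1) assms(1)] .
      ultimately show False using w(2) by simp
    qed
    then obtain g where g: "g \<in> G" "n g \<le> count_list w g" ..
    have "set w \<subseteq> carrier R" using w assms(2) by blast
    moreover have "\<one> \<otimes> word w = \<zero>"
      using g n assms(2) calculation by (intro word_zero[of \<one> g w "n g"]) auto
    ultimately show ?thesis by simp
  qed
  then show ?thesis by (intro exI[of _ ?m]) (auto simp: words_def)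
qed

text \<open>
  Here \<open>e\<close> acts as the identity of the corner, and the generator \<open>p e\<close> makes every quotient of
  consecutive spans elementary abelian. Nilpotency is the pigeonhole principle for long words.
\<close>
lemma words_filtration:
  assumes "finite (carrier R)" "prime p" "G \<subseteq> carrier R" "\<And>g. g \<in> G \<Longrightarrow> \<exists>n::nat. g [^] n = \<zero>"
    "e \<in> carrier R" "\<And>g. g \<in> G \<Longrightarrow> e \<otimes> g = g" "[(int p)] \<cdot> e \<in> G"
  shows "\<exists>m>0. nilpotent_filtration R p (\<lambda>k. additive_span (words G k)) m"
proof -
  have "finite G" using assms finite_subset by blast
  then obtain m where m: "0 < m" "words G m \<subseteq> {\<zero>}" using long_words_zero[OF _ assms(3,4)] by blast
  note wc = words_closed[OF assms(3)]
  note sub = span_subgroup[OF wc]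
  have mult: "x \<otimes> y \<in> additive_span (words G (i + j))" if "x \<in> additive_span (words G i)" "y \<in> additive_span (words G j)" for x y i j
  proof (rule span_mult_subset[OF sub wc wc _ that])
    fix s t assume "s \<in> words G i" "t \<in> words G j"
    then obtain v w where vw: "s = word v" "t = word w" "set v \<subseteq> G" "set w \<subseteq> G" "i \<le> length v" "j \<le> length w"
      by (auto simp: words_def)
    then have "s \<otimes> t = word (v @ w)" using assms(3) word_append[of v w] by auto
    moreover have "word (v @ w) \<in> words G (i + j)" 
      unfolding words_def using vw by (intro CollectI exI[of _ "v @ w"]) auto
    ultimately show "s \<otimes> t \<in> additive_span (words G (i + j))" using span_superset by auto
  qed
  have "nilpotent_filtration R p (\<lambda>k. additive_span (words G k)) m"
  proof (intro nilpotent_filtration.intro nilpotent_filtration_axioms.intro reversible_ring_axioms)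
    show "additive_span (words G (Suc k)) \<subseteq> additive_span (words G k)" for k
      by (intro span_minimal sub order_trans[OF _ span_superset]) (auto simp: words_def)
  next
    fix P i j assume P: "additive_subgroup P R"
      and prod: "\<And>u v. \<lbrakk>u \<in> additive_span (words G i); v \<in> additive_span (words G j)\<rbrakk> \<Longrightarrow> u \<otimes> v \<in> P"
    have "words G (i + j) \<subseteq> P"
    proof
      fix x assume "x \<in> words G (i + j)"
      then obtain w where w: "x = word w" "set w \<subseteq> G" "i + j \<le> length w" by (auto simp: words_def)
      have tk: "set (take i w) \<subseteq> G" "set (drop i w) \<subseteq> G"
        using w(2) set_take_subset[of i w] set_drop_subset[of i w] by auto
      have "x = word (take i w) \<otimes> word (drop i w)"
        using word_append[of "take i w" "drop i w"] tk assms(3) by (simp add: w(1))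
      moreover have "word (take i w) \<in> words G i" "word (drop i w) \<in> words G j"
        using tk w(3) unfolding words_def by fastforce+
      ultimately show "x \<in> P" using prod span_superset by blast
    qed
    then show "additive_span (words G (i + j)) \<subseteq> P" using span_minimal P by blast
  next
    fix k x assume k: "0 < k" and x: "x \<in> additive_span (words G k)"
    have "additive_subgroup {t \<in> carrier R. e \<otimes> t = t} R"
      using assms(5) by (intro additive_subgroupI add.subgroupI) (auto simp: r_distr r_minus)
    moreover have "words G k \<subseteq> {t \<in> carrier R. e \<otimes> t = t}"
    proof
      fix t assume "t \<in> words G k"
      then obtain w where w: "t = word w" "set w \<subseteq> G" "k \<le> length w" by (auto simp: words_def)
      then obtain g v where gv: "w = g # v" using k by (cases w) auto
      have "g \<in> G" "set v \<subseteq> carrier R" using w gv assms(3) by auto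
      then have "e \<otimes> t = t" using assms(3,5,6) gv w by (auto simp flip: m_assoc)
      moreover have "t \<in> carrier R" using w assms(3) by auto
      ultimately show "t \<in> {t \<in> carrier R. e \<otimes> t = t}" by simp
    qed
    ultimately have ex: "x \<in> carrier R" "e \<otimes> x = x" using span_minimal x by blast+
    have "[(int p)] \<cdot> e = word [[(int p)] \<cdot> e]" using assms(5) by simp
    then have "[(int p)] \<cdot> e \<in> words G 1"
      unfolding words_def using assms(7) by (intro CollectI exI[of _ "[[(int p)] \<cdot> e]"]) auto
    then have "[(int p)] \<cdot> e \<otimes> x \<in> additive_span (words G (1 + k))" using mult x span_superset by blast
    moreover have "[(int p)] \<cdot> e \<otimes> x = [(int p)] \<cdot> x" using ex assms(5) add_pow_ldistr_int by metis
    ultimately show "[(int p)] \<cdot> x \<in> additive_span (words G (Suc k))" by simp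
  next
    have "additive_subgroup {\<zero>} R"
      by (intro additive_subgroupI add.subgroupI) auto
    then show "additive_span (words G m) = {\<zero>}"
      using span_minimal m(2) additive_subgroup.zero_closed[OF sub] by blast
  qed (use assms sub mult in auto)
  then show ?thesis using m by blast
qed

text \<open>
  If \<open>n\<close> is the additive order of \<open>t\<close> and \<open>p\<close> a prime divisor of \<open>n\<close>, take \<open>q = n / p\<close>.
\<close>
lemma prime_torsion_multiple:
  assumes "finite (carrier R)" "t \<in> carrier R" "t \<noteq> \<zero>"
  shows "\<exists>p q. prime (p::nat) \<and> [(int q)] \<cdot> t \<noteq> \<zero> \<and> [(int p)] \<cdot> ([(int q)] \<cdot> t) = \<zero>"
proof -
  let ?Z = "\<lambda>n::nat. 0 < n \<and> [(int n)] \<cdot> t = \<zero>"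
  have "[(order (add_monoid R))] \<cdot> t = \<zero>"
    using add.pow_order_eq_1[of t] assms by simp
  moreover have "0 < order (add_monoid R)"
    using assms(1,2) by (auto simp: order_def card_gt_0_iff)
  ultimately have ex: "?Z (order (add_monoid R))" by (simp add: add_pow_int_ge)
  define n where "n = (LEAST n. ?Z n)"
  have n: "?Z n" unfolding n_def using ex by (rule LeastI)
  have "n \<noteq> 1" using n assms by auto
  then obtain p where p: "prime p" "p dvd n" using prime_factor_nat by blast
  then obtain q where q: "n = p * q" by blast
  have "0 < q" using n q by (metis mult_0_right not_gr_zero)
  moreover from this have "q < n" using q prime_gt_1_nat[OF p(1)] by simp
  ultimately have "[(int q)] \<cdot> t \<noteq> \<zero>" using not_less_Least[of q ?Z] unfolding n_def by blast
  moreover have "[(int p)] \<cdot> ([(int q)] \<cdot> t) = \<zero>"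
    using n assms(2) unfolding q by (simp add: add.int_pow_pow mult.commute)
  ultimately show ?thesis using p(1) by blast
qed

text \<open>
  A multiple of \<open>c\<close> makes \<open>t = bac\<close> nonzero of prime additive order \<open>p\<close>. Each idempotent power of \<open>a\<close>,
  \<open>b\<close>, \<open>c\<close> or \<open>p 1\<close> annihilates \<open>t\<close>: for the first three because inserting factors into
  \<open>abc = 0\<close> and moving a central idempotent to the front produces \<open>e bac = 0\<close>. So there is a corner \<open>e\<close> containing \<open>t\<close>
  in which all four elements are nilpotent. They generate a nilpotent filtration that contains a
  nonsymmetric triple, and adjoining \<open>e\<close> itself contributes one more factor \<open>p\<close> to the order.
\<close>
theorem nonsymmetric_order_bound:
  assumes fin: "finite (carrier R)" and car: "a \<in> carrier R" "b \<in> carrier R" "c0 \<in> carrier R"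
    and zero0: "a \<otimes> b \<otimes> c0 = \<zero>" and nz0: "b \<otimes> a \<otimes> c0 \<noteq> \<zero>"
  shows "256 \<le> order R"
proof -
  have "b \<otimes> a \<otimes> c0 \<in> carrier R" using car by simp
  from prime_torsion_multiple[OF fin this nz0]
  obtain p q :: nat where p: "prime p" and q: "[(int q)] \<cdot> (b \<otimes> a \<otimes> c0) \<noteq> \<zero>"
    "[(int p)] \<cdot> ([(int q)] \<cdot> (b \<otimes> a \<otimes> c0)) = \<zero>"
    by blast
  define c where "c = [(int q)] \<cdot> c0"
  have c: "c \<in> carrier R" using car by (simp add: c_def)
  define t where "t = b \<otimes> a \<otimes> c"
  have t: "t \<in> carrier R" "t \<noteq> \<zero>" "[(int p)] \<cdot> t = \<zero>"
    using q car by (simp_all add: t_def c_def add_pow_rdistr_int)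
  have zero: "a \<otimes> b \<otimes> c = \<zero>" using zero0 car by (simp add: c_def add_pow_rdistr_int)
  define P where "P = [(int p)] \<cdot> \<one>"
  have P: "P \<in> carrier R" by (simp add: P_def)
  have Pm: "P \<otimes> x = [(int p)] \<cdot> x" if "x \<in> carrier R" for x
    using that by (simp add: P_def add_pow_ldistr_int)
  have annihilate: "g [^] n \<otimes> t = \<zero>"
    if g: "g \<in> {a, b, c, P}" and n: "0 < (n::nat)" and idem: "g [^] n \<otimes> g [^] n = g [^] n" for g n
  proof -
    let ?e = "g [^] n"
    obtain k where k: "n = Suc k" using n by (cases n) auto
    have e: "?e \<in> carrier R" using g car c P by auto
    have central: "?e \<otimes> x = x \<otimes> ?e" if "x \<in> carrier R" for x
      using idempotent_central[OF e idem that] .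
    consider "g = a" | "g = b" | "g = c" | "g = P" using g by blast
    then show ?thesis
    proof cases
      case 1
      have "?e \<otimes> b \<otimes> c = a [^] k \<otimes> (a \<otimes> b \<otimes> c)" using 1 k car c by (simp add: m_assoc)
      then have "?e \<otimes> b \<otimes> c = \<zero>" using zero car 1 by simp
      then have "?e \<otimes> b \<otimes> a \<otimes> c = \<zero>" using zero_insert e car c by simp
      then show ?thesis using e car c by (simp add: t_def m_assoc)
    next
      case 2
      have "a \<otimes> b \<otimes> b [^] k \<otimes> c = \<zero>" using zero_insert[OF _ c _ zero] car by simp
      moreover have "b \<otimes> b [^] k = ?e" using nat_pow_Suc2[OF car(2)] by (simp add: k 2)
      ultimately have "a \<otimes> ?e \<otimes> c = \<zero>" using car c by (simp add: m_assoc)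
      then have "?e \<otimes> a \<otimes> c = \<zero>" using central car by simp
      then have "b \<otimes> (?e \<otimes> a \<otimes> c) = \<zero>" using car by simp
      then have "(b \<otimes> ?e) \<otimes> a \<otimes> c = \<zero>" using car c e by (simp add: m_assoc)
      then have "?e \<otimes> b \<otimes> a \<otimes> c = \<zero>" by (simp only: central[OF car(2)])
      then show ?thesis using car c e by (simp add: t_def m_assoc)
    next
      case 3
      have "c \<otimes> c [^] k = ?e" using nat_pow_Suc2[OF c] by (simp add: k 3)
      moreover have "a \<otimes> b \<otimes> (c \<otimes> c [^] k) = \<zero>" using zero car c by (simp flip: m_assoc)
      ultimately have "a \<otimes> (b \<otimes> ?e) = \<zero>" using car e by (simp add: m_assoc)
      then have "b \<otimes> ?e \<otimes> a = \<zero>" using reversible car e by simp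
      then have "?e \<otimes> b \<otimes> a = \<zero>" using central car by simp
      then have "?e \<otimes> b \<otimes> a \<otimes> c = \<zero>" using c by simp
      then show ?thesis using e car c by (simp add: t_def m_assoc)
    next
      case 4
      have "?e \<otimes> t = P [^] k \<otimes> (P \<otimes> t)" using 4 k P t by (simp add: m_assoc)
      then show ?thesis using Pm t P by simp
    qed
  qed
  obtain e where e: "e \<in> carrier R" "e \<otimes> e = e" "e \<otimes> t = t"
    and nil: "\<And>g. g \<in> {a, b, c, P} \<Longrightarrow> \<exists>n>0::nat. (e \<otimes> g) [^] n = \<zero>"
    using common_nilpotent_corner[OF fin _ _ t(1), of "{a, b, c, P}"] annihilate car c P by auto
  define G where "G = (\<otimes>) e ` {a, b, c, P}"
  have central: "x \<otimes> e = e \<otimes> x" if "x \<in> carrier R" for x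
    using idempotent_central[OF e(1,2) that] by simp
  have eP: "e \<otimes> P = [(int p)] \<cdot> e" using central[OF P] Pm e by simp
  have Gc: "G \<subseteq> carrier R" using e car c P by (auto simp: G_def)
  have "\<exists>m>0. nilpotent_filtration R p (\<lambda>k. additive_span (words G k)) m"
  proof (rule words_filtration[OF fin p Gc _ e(1)])
    fix g assume "g \<in> G"
    then obtain h where h: "h \<in> {a, b, c, P}" "g = e \<otimes> h" by (auto simp: G_def)
    show "\<exists>n::nat. g [^] n = \<zero>" using nil[OF h(1)] h(2) by blast
    have "h \<in> carrier R" using h car c P by auto
    then show "e \<otimes> g = g" using h(2) e(1,2) by (simp flip: m_assoc)
  next
    show "[(int p)] \<cdot> e \<in> G" using eP by (auto simp: G_def intro!: image_eqI[of _ _ P])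
  qed
  then obtain m where "0 < m" and "nilpotent_filtration R p (\<lambda>k. additive_span (words G k)) m" by blast
  then interpret nilpotent_filtration R p "\<lambda>k. additive_span (words G k)" m by simp
  let ?J = "additive_span (words G 1)"
  have GJ: "G \<subseteq> ?J"
  proof
    fix g assume "g \<in> G"
    then have "word [g] \<in> words G 1" unfolding words_def by (intro CollectI exI[of _ "[g]"]) auto
    then have "g \<in> words G 1" using \<open>g \<in> G\<close> Gc by auto
    then show "g \<in> ?J" using span_superset by blast
  qed
  have collect: "e \<otimes> x \<otimes> (e \<otimes> y) \<otimes> (e \<otimes> z) = e \<otimes> (x \<otimes> y \<otimes> z)"
    if "x \<in> carrier R" "y \<in> carrier R" "z \<in> carrier R" for x y z
  proof -
    have two: "e \<otimes> r \<otimes> (e \<otimes> s) = e \<otimes> (r \<otimes> s)" if "r \<in> carrier R" "s \<in> carrier R" for r s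
    proof -
      have "e \<otimes> r \<otimes> (e \<otimes> s) = e \<otimes> (r \<otimes> e) \<otimes> s" using that e(1) by (simp add: m_assoc)
      also have "\<dots> = e \<otimes> (e \<otimes> r) \<otimes> s" by (simp only: central[OF that(1)])
      also have "\<dots> = (e \<otimes> e) \<otimes> (r \<otimes> s)" using that e(1) by (simp add: m_assoc)
      finally show ?thesis using e(2) by simp
    qed
    show ?thesis using two[of x y] two[of "x \<otimes> y" z] that by simp
  qed
  have z: "e \<otimes> a \<otimes> (e \<otimes> b) \<otimes> (e \<otimes> c) = \<zero>" using collect car c zero e by simp
  have "e \<otimes> b \<otimes> (e \<otimes> a) \<otimes> (e \<otimes> c) = t" using collect car c e by (simp add: t_def)
  then have nz: "e \<otimes> c \<otimes> (e \<otimes> b) \<otimes> (e \<otimes> a) \<noteq> \<zero>"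
    using zero_rotate(1)[of "e \<otimes> c" "e \<otimes> b" "e \<otimes> a"] t(2) e(1) car c by auto
  have mem: "e \<otimes> a \<in> ?J" "e \<otimes> b \<in> ?J" "e \<otimes> c \<in> ?J" "[(int p)] \<cdot> e \<in> ?J"
    using GJ eP by (auto simp: G_def)
  have "e \<notin> ?J"
  proof
    assume "e \<in> ?J"
    then have "e = \<zero>" using idempotent_eq_zero e(2) \<open>0 < m\<close> by blast
    then show False using e(3) t by simp
  qed
  then have "p * card ?J = card (adjoin e ?J)"
    using card_adjoin[OF J_subgroup J_finite e(1) _ p mem(4)] by simp
  also have "\<dots> \<le> card (carrier R)"
    using adjoin_subgroup[OF J_subgroup e(1)] additive_subgroup.a_subset fin by (blast intro: card_mono)
  finally show ?thesis
    using nonsymmetric_card_bound[OF mem(1-3) z nz] by (simp add: order_def)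
qed

end


theorem reversible_small_symmetric:
  fixes R (structure)
  assumes "reversible_ring R" "finite (carrier R)" "order R < 256"
  shows "symmetric_ring R"
proof -
  interpret reversible_ring R by fact
  show ?thesis
  proof
    fix a b c
    assume "a \<in> carrier R" "b \<in> carrier R" "c \<in> carrier R" "a \<otimes> b \<otimes> c = \<zero>"
    then show "b \<otimes> a \<otimes> c = \<zero>"
      using nonsymmetric_order_bound[OF assms(2), of a b c] assms(3) by force
  qed
qed

section \<open>The minimal order\<close>

theorem theorem3p1:
  shows "(\<exists>R :: nat ring. reversible_ring R \<and> finite (carrier R) \<and> order R = 256 \<and> \<not> symmetric_ring R)
    \<and> (\<forall>R :: ('a, 'm) ring_scheme. reversible_ring R \<longrightarrow> finite (carrier R) \<longrightarrow> order R < 256 \<longrightarrow> symmetric_ring R)"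
  using reversible_nonsymmetric_256 reversible_small_symmetric by blast

end
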